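(* (SUCI3.) Let $s=3$, $\gamma_0=0$, $\gamma_3=1$, and let $\gamma_1>0$ and $\gamma_2$ be real with $\gamma_2\ne0$, $\gamma_2\neq\gamma_1$. Set $\alpha_{10}=\alpha_{11}=\alpha_{22}=\alpha_{33}=\gamma_1/2$ and $$\alpha_{32}=\frac{3\gamma_1^2-6\gamma_1+2}{6\gamma_2(\gamma_2-\gamma_1)},\quad \alpha_{20}=\frac{-\gamma_1^2+3\gamma_1\gamma_2-\gamma_2^2}{2\gamma_1},\quad \alpha_{21}=\frac{\gamma_2(\gamma_2-\gamma_1)}{2\gamma_1},$$ $$\alpha_{30}=\frac{-\gamma_1^2+(3-2\alpha_{32})\gamma_1+2\alpha_{32}\gamma_2-1}{2\gamma_1},\quad \alpha_{31}=\frac{-2\alpha_{32}\gamma_2-\gamma_1+1}{2\gamma_1}.$$ Let $$R_\infty(\gamma_1)=\frac{3\gamma_1^3-18\gamma_1^2+18\gamma_1-4}{3\gamma_1^3}.$$ Then the three-sub-step method with these parameters has the following properties. (a) It is third-order accurate. (b) It is unconditionally stable if and only if $$\left(\gamma_1-\tfrac13\right)\left(\gamma_1-\tfrac23\right)\left(\gamma_1^3-3\gamma_1^2+3\gamma_1-\tfrac23\right)\ge0\quad\text{and}\quad-\tfrac43\gamma_1^3+4\gamma_1^2-\tfrac83\gamma_1+\tfrac49\ge0,$$ equivalently if and only if $\gamma_1\in[\tfrac23,\gamma^*]$, where $\gamma^*$ is a real number with $|\gamma^*-2.137158043|\le10^{-8}$. (c) As $\omega\to\infty$ with $\Delta t>0$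 and $\xi\in[0,1)$ fixed, the characteristic polynomial of $\mathbf D_{num}$ tends to $(\zeta-R_\infty(\gamma_1))^2$; and for every $\rho_\infty\in[0,1]$ there is a $\gamma_1\in[\tfrac23,\gamma^*]$ with $R_\infty(\gamma_1)=\rho_\infty$. (d) (Zero-order overshoots.) If $f=0$, then for any initial data $u_0,\dot u_0$ the numerical solution after the first step satisfies $u_1\to R_\infty(\gamma_1)u_0$ and $\dot u_1\to R_\infty(\gamma_1)\dot u_0$ as $\Delta t\to\infty$.
   Context: The $s$-sub-step method. For the scalar equation $\ddot u(t)+2\xi\omega\dot u(t)+\omega^2u(t)=f(t)$ with $\omega>0$, $\xi\in[0,1)$, and a step from $t_n$ to $t_{n+1}=t_n+\Delta t$ starting from $(u_n,\dot u_n)$ with $\ddot u_n=f(t_n)-2\xi\omega\dot u_n-\omega^2u_n$, the $s$-sub-step method computes, for $i=1,\dots,s$, $$\ddot u_{n+\gamma_i}+2\xi\omega\dot u_{n+\gamma_i}+\omega^2u_{n+\gamma_i}=f(t_n+\gamma_i\Delta t),\quad u_{n+\gamma_i}=u_n+\Delta t\sum_{j=0}^{i}\alpha_{ij}\dot u_{n+\gamma_j},\quad \dot u_{n+\gamma_i}=\dot u_n+\Delta t\sum_{j=0}^{i}\alpha_{ij}\ddot u_{n+\gamma_j},$$ where $\gamma_0=0$, $\gamma_s=1$, and $u_{n+\gamma_0}=u_n$ (similarly for derivatives). The numerical solution at $t_{n+1}$ is $(u_{n+1},\dot u_{n+1})=(u_{n+\gamma_s},\dot u_{n+\gamma_s})$.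 It has the form $(u_{n+1},\dot u_{n+1})^{\mathsf T}=\mathbf D_{num}(u_n,\dot u_n)^{\mathsf T}+\mathbf L_{num}$, where the $2\times2$ amplification matrix $\mathbf D_{num}$ depends on $\xi,\omega,\Delta t$ and the parameters, and $\mathbf L_{num}$ depends also on $f$. Exact solution operators. Take $t_n=0$ and $f(t)=\exp(t)$. The exact solution with data $(u_n,\dot u_n)$ at $t_n$ satisfies $(u(t_{n+1}),\dot u(t_{n+1}))^{\mathsf T}=\mathbf D_{exa}(u_n,\dot u_n)^{\mathsf T}+\mathbf L_{exa}$, where $\mathbf D_{exa}$ is the exact $2\times 2$ propagator of the homogeneous equation over time $\Delta t$ and $\mathbf L_{exa}$ is the value at time $\Delta t$ of (displacement, velocity) for the solution with load $\exp(t)$ and zero data at $t=0$. $p$th-order accuracy: for all $\omega>0$, $\xi\in[0,1)$, with load $f(t)=\exp(t)$ and $t_n=0$, one has $\mathbf D_{num}-\mathbf D_{exa}=O(\Delta t^{p+1})$ and $\mathbf L_{num}-\mathbf L_{exa}=O(\Delta t^{p+1})$ entrywise as $\Delta t\to0$. Unconditional stability: for $\xi=0$ the spectral radius of $\mathbf D_{num}$ is at most $1$ for all $\Omega=\omega\Delta t\in[0,\infty)$. *)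

theory Defs
  imports
    Complex_Main
    "HOL-Library.Landau_Symbols"
    "Jordan_Normal_Form.Spectral_Radius"
begin

text \<open>The test equation is \<open>u'' + 2 \<xi> \<omega> u' + \<omega>\<^sup>2 u = f\<close>. A state (displacement, velocity) is a
  real vector of dimension 2. Throughout, \<open>h\<close> is the step size and a method is given by a number
  \<open>s\<close> of sub-steps, nodes \<open>\<gamma>\<close> and coefficients \<open>\<alpha>\<close>; only \<open>\<gamma> i\<close> for \<open>i \<le> s\<close> and
  \<open>\<alpha> i j\<close> for \<open>1 \<le> i \<le> s\<close>, \<open>j \<le> i\<close> matter.\<close>


section \<open>The sub-step method\<close>

definition substep_stages ::
  "nat \<Rightarrow> (nat \<Rightarrow> real) \<Rightarrow> (nat \<Rightarrow> nat \<Rightarrow> real) \<Rightarrow> real \<Rightarrow> real \<Rightarrow> (real \<Rightarrow> real) \<Rightarrow> real \<Rightarrow> real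
    \<Rightarrow> real vec \<Rightarrow> (nat \<Rightarrow> real) \<Rightarrow> (nat \<Rightarrow> real) \<Rightarrow> (nat \<Rightarrow> real) \<Rightarrow> bool" where
  "substep_stages s \<gamma> \<alpha> \<xi> \<omega> f t h x u v a \<longleftrightarrow>
     u 0 = x $ 0 \<and> v 0 = x $ 1 \<and> a 0 = f t - 2 * \<xi> * \<omega> * v 0 - \<omega>\<^sup>2 * u 0 \<and>
     (\<forall>i\<in>{1..s}.
        a i + 2 * \<xi> * \<omega> * v i + \<omega>\<^sup>2 * u i = f (t + \<gamma> i * h) \<and>
        u i = u 0 + h * (\<Sum>j\<le>i. \<alpha> i j * v j) \<and>
        v i = v 0 + h * (\<Sum>j\<le>i. \<alpha> i j * a j))"

definition num_step ::
  "nat \<Rightarrow> (nat \<Rightarrow> real) \<Rightarrow> (nat \<Rightarrow> nat \<Rightarrow> real) \<Rightarrow> real \<Rightarrow> real \<Rightarrow> (real \<Rightarrow> real) \<Rightarrow> real \<Rightarrow> real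
    \<Rightarrow> real vec \<Rightarrow> real vec" where
  "num_step s \<gamma> \<alpha> \<xi> \<omega> f t h x =
     (THE y. \<exists>u v a. substep_stages s \<gamma> \<alpha> \<xi> \<omega> f t h x u v a \<and> y = vec_of_list [u s, v s])"

definition D_num ::
  "nat \<Rightarrow> (nat \<Rightarrow> real) \<Rightarrow> (nat \<Rightarrow> nat \<Rightarrow> real) \<Rightarrow> real \<Rightarrow> real \<Rightarrow> real \<Rightarrow> real mat" where
  "D_num s \<gamma> \<alpha> \<xi> \<omega> h =
     (THE D. D \<in> carrier_mat 2 2 \<and>
        (\<forall>f t. \<exists>L\<in>carrier_vec 2. \<forall>x\<in>carrier_vec 2.
           num_step s \<gamma> \<alpha> \<xi> \<omega> f t h x = D *\<^sub>v x + L))"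

definition L_num ::
  "nat \<Rightarrow> (nat \<Rightarrow> real) \<Rightarrow> (nat \<Rightarrow> nat \<Rightarrow> real) \<Rightarrow> real \<Rightarrow> real \<Rightarrow> (real \<Rightarrow> real) \<Rightarrow> real \<Rightarrow> real
    \<Rightarrow> real vec" where
  "L_num s \<gamma> \<alpha> \<xi> \<omega> f t h =
     (THE L. L \<in> carrier_vec 2 \<and>
        (\<forall>x\<in>carrier_vec 2. num_step s \<gamma> \<alpha> \<xi> \<omega> f t h x = D_num s \<gamma> \<alpha> \<xi> \<omega> h *\<^sub>v x + L))"


section \<open>The exact solution operators\<close>

definition exact_solution ::
  "real \<Rightarrow> real \<Rightarrow> (real \<Rightarrow> real) \<Rightarrow> (real \<Rightarrow> real) \<Rightarrow> (real \<Rightarrow> real) \<Rightarrow> bool" where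
  "exact_solution \<xi> \<omega> f u v \<longleftrightarrow>
     (\<forall>t. (u has_real_derivative v t) (at t) \<and>
          (v has_real_derivative f t - 2 * \<xi> * \<omega> * v t - \<omega>\<^sup>2 * u t) (at t))"

definition D_exa :: "real \<Rightarrow> real \<Rightarrow> real \<Rightarrow> real mat" where
  "D_exa \<xi> \<omega> h =
     (THE D. D \<in> carrier_mat 2 2 \<and>
        (\<forall>u v. exact_solution \<xi> \<omega> (\<lambda>_. 0) u v \<longrightarrow>
           vec_of_list [u h, v h] = D *\<^sub>v vec_of_list [u 0, v 0]))"

definition L_exa :: "real \<Rightarrow> real \<Rightarrow> real \<Rightarrow> real vec" where
  "L_exa \<xi> \<omega> h =
     (THE L. \<exists>u v. exact_solution \<xi> \<omega> exp u v \<and> u 0 = 0 \<and> v 0 = 0 \<and> L = vec_of_list [u h, v h])"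


section \<open>Accuracy and stability\<close>

definition accurate_of_order ::
  "nat \<Rightarrow> nat \<Rightarrow> (nat \<Rightarrow> real) \<Rightarrow> (nat \<Rightarrow> nat \<Rightarrow> real) \<Rightarrow> bool" where
  "accurate_of_order p s \<gamma> \<alpha> \<longleftrightarrow>
     (\<forall>\<omega>>0. \<forall>\<xi>\<in>{0..<1}. \<forall>i<2.
        (\<forall>j<2. (\<lambda>h. D_num s \<gamma> \<alpha> \<xi> \<omega> h $$ (i, j) - D_exa \<xi> \<omega> h $$ (i, j))
                 \<in> O[at_right 0](\<lambda>h. h ^ (p + 1))) \<and>
        (\<lambda>h. L_num s \<gamma> \<alpha> \<xi> \<omega> exp 0 h $ i - L_exa \<xi> \<omega> h $ i) \<in> O[at_right 0](\<lambda>h. h ^ (p + 1)))"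

definition unconditionally_stable ::
  "nat \<Rightarrow> (nat \<Rightarrow> real) \<Rightarrow> (nat \<Rightarrow> nat \<Rightarrow> real) \<Rightarrow> bool" where
  "unconditionally_stable s \<gamma> \<alpha> \<longleftrightarrow>
     (\<forall>\<omega>>0. \<forall>h\<ge>0. spectral_radius (map_mat complex_of_real (D_num s \<gamma> \<alpha> 0 \<omega> h)) \<le> 1)"


section \<open>The method SUCI3\<close>

definition suci3_nodes :: "real \<Rightarrow> real \<Rightarrow> nat \<Rightarrow> real" where
  "suci3_nodes \<gamma>1 \<gamma>2 i = [0, \<gamma>1, \<gamma>2, 1] ! i"

definition suci3_coeffs :: "real \<Rightarrow> real \<Rightarrow> nat \<Rightarrow> nat \<Rightarrow> real" where
  "suci3_coeffs \<gamma>1 \<gamma>2 i j =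
     (let \<alpha>32 = (3 * \<gamma>1\<^sup>2 - 6 * \<gamma>1 + 2) / (6 * \<gamma>2 * (\<gamma>2 - \<gamma>1));
          \<alpha>20 = (- \<gamma>1\<^sup>2 + 3 * \<gamma>1 * \<gamma>2 - \<gamma>2\<^sup>2) / (2 * \<gamma>1);
          \<alpha>21 = \<gamma>2 * (\<gamma>2 - \<gamma>1) / (2 * \<gamma>1);
          \<alpha>30 = (- \<gamma>1\<^sup>2 + (3 - 2 * \<alpha>32) * \<gamma>1 + 2 * \<alpha>32 * \<gamma>2 - 1) / (2 * \<gamma>1);
          \<alpha>31 = (- 2 * \<alpha>32 * \<gamma>2 - \<gamma>1 + 1) / (2 * \<gamma>1)
      in [[0,      0,      0,      0     ],
          [\<gamma>1 / 2, \<gamma>1 / 2, 0,      0     ],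
          [\<alpha>20,    \<alpha>21,    \<gamma>1 / 2, 0     ],
          [\<alpha>30,    \<alpha>31,    \<alpha>32,    \<gamma>1 / 2]] ! i ! j)"

definition R_inf :: "real \<Rightarrow> real" where
  "R_inf \<gamma>1 = (3 * \<gamma>1 ^ 3 - 18 * \<gamma>1\<^sup>2 + 18 * \<gamma>1 - 4) / (3 * \<gamma>1 ^ 3)"


section \<open>The definite descriptions above are proper\<close>

lemma vec_of_list_2_eq_iff [simp]:
  "vec_of_list [a, b] = vec_of_list [c, d] \<longleftrightarrow> a = c \<and> b = d"
  by (metis list.inject list_vec)

lemma vec_of_list_2_carrier [simp]: "vec_of_list [a, b] \<in> carrier_vec 2"
  by (intro carrier_vecI) simp

lemma carrier_vec_2_eq: "x \<in> carrier_vec 2 \<Longrightarrow> x = vec_of_list [x $ 0, x $ 1]"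
  by (intro eq_vecI) (auto simp: less_2_cases_iff less_Suc_eq)

lemma vec_of_list_2_add:
  "vec_of_list [a, b] + vec_of_list [c, d] = vec_of_list [a + c, b + d :: real]"
  by (intro eq_vecI) (auto simp: less_Suc_eq)

lemma mult_mat_vec_of_list_2:
  fixes D :: "real mat"
  assumes "D \<in> carrier_mat 2 2"
  shows "D *\<^sub>v vec_of_list [a, b] =
    vec_of_list [D $$ (0, 0) * a + D $$ (0, 1) * b, D $$ (1, 0) * a + D $$ (1, 1) * b]"
  using assms
  by (intro eq_vecI) (auto simp: less_Suc_eq scalar_prod_def numeral_2_eq_2)

lemma mat_2_eqI:
  fixes D E :: "real mat"
  assumes D: "D \<in> carrier_mat 2 2" and E: "E \<in> carrier_mat 2 2"
    and eq: "\<And>x. x \<in> carrier_vec 2 \<Longrightarrow> D *\<^sub>v x = E *\<^sub>v x"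
  shows "D = E"
proof -
  have "D *\<^sub>v vec_of_list [1, 0] = E *\<^sub>v vec_of_list [1, 0]"
    "D *\<^sub>v vec_of_list [0, 1] = E *\<^sub>v vec_of_list [0, 1]"
    by (rule eq, simp del: vec_of_list_Cons)+
  then have "D $$ (0, 0) = E $$ (0, 0)" "D $$ (0, 1) = E $$ (0, 1)"
    "D $$ (1, 0) = E $$ (1, 0)" "D $$ (1, 1) = E $$ (1, 1)"
    unfolding mult_mat_vec_of_list_2[OF D] mult_mat_vec_of_list_2[OF E] vec_of_list_2_eq_iff
    by auto
  then show ?thesis
    using D E by (intro eq_matI) (auto simp: less_2_cases_iff)
qed

text \<open>For \<open>\<bar>\<xi>\<bar> < 1\<close> the implicit stage equations are uniquely solvable, since eliminating \<open>u i\<close>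
  and \<open>v i\<close> leaves \<open>a i\<close> with the factor below.\<close>

lemma stage_factor_pos:
  fixes \<xi> \<omega> k :: real
  assumes "\<bar>\<xi>\<bar> < 1"
  shows "1 + 2 * \<xi> * \<omega> * k + \<omega>\<^sup>2 * k\<^sup>2 > 0"
proof -
  have eq: "1 + 2 * \<xi> * \<omega> * k + \<omega>\<^sup>2 * k\<^sup>2 = (1 + \<xi> * (\<omega> * k))\<^sup>2 + (1 - \<xi>\<^sup>2) * (\<omega> * k)\<^sup>2"
    by (simp add: power2_eq_square algebra_simps)
  have \<xi>: "1 - \<xi>\<^sup>2 > 0" using assms by (simp add: abs_square_less_1)
  show ?thesis
  proof (cases "\<omega> * k = 0")
    case True
    show ?thesis unfolding eq True by simp
  next
    case False
    then show ?thesis unfolding eq using \<xi> by (intro add_nonneg_pos mult_pos_pos) auto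
  qed
qed

lemma stage_system_iff:
  fixes \<xi> \<omega> k U V F a v u :: real
  assumes "\<bar>\<xi>\<bar> < 1"
  shows "(a + 2 * \<xi> * \<omega> * v + \<omega>\<^sup>2 * u = F \<and> u = U + k * v \<and> v = V + k * a) \<longleftrightarrow>
    (a = (F - 2 * \<xi> * \<omega> * V - \<omega>\<^sup>2 * (U + k * V)) / (1 + 2 * \<xi> * \<omega> * k + \<omega>\<^sup>2 * k\<^sup>2) \<and>
     v = V + k * a \<and> u = U + k * v)"
proof -
  note p = stage_factor_pos[OF assms, of \<omega> k]
  have "a = (F - 2 * \<xi> * \<omega> * V - \<omega>\<^sup>2 * (U + k * V)) / (1 + 2 * \<xi> * \<omega> * k + \<omega>\<^sup>2 * k\<^sup>2) \<longleftrightarrow>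
    a * (1 + 2 * \<xi> * \<omega> * k + \<omega>\<^sup>2 * k\<^sup>2) = F - 2 * \<xi> * \<omega> * V - \<omega>\<^sup>2 * (U + k * V)"
    using p by (simp add: eq_divide_eq)
  also have "\<dots> \<longleftrightarrow> a + 2 * \<xi> * \<omega> * (V + k * a) + \<omega>\<^sup>2 * (U + k * (V + k * a)) = F"
    by (auto simp: algebra_simps power2_eq_square)
  finally show ?thesis by auto
qed

lemma substep_stages_Suc:
  "substep_stages (Suc s) \<gamma> \<alpha> \<xi> \<omega> f t h x u v a \<longleftrightarrow>
     substep_stages s \<gamma> \<alpha> \<xi> \<omega> f t h x u v a \<and>
     (a (Suc s) + 2 * \<xi> * \<omega> * v (Suc s) + \<omega>\<^sup>2 * u (Suc s) = f (t + \<gamma> (Suc s) * h) \<and>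
      u (Suc s) = u 0 + h * (\<Sum>j\<le>s. \<alpha> (Suc s) j * v j) + h * \<alpha> (Suc s) (Suc s) * v (Suc s) \<and>
      v (Suc s) = v 0 + h * (\<Sum>j\<le>s. \<alpha> (Suc s) j * a j) + h * \<alpha> (Suc s) (Suc s) * a (Suc s))"
proof -
  have "{1..Suc s} = insert (Suc s) {1..s}" by auto
  moreover have "z + h * (\<Sum>j\<le>Suc s. \<alpha> (Suc s) j * w j) =
      z + h * (\<Sum>j\<le>s. \<alpha> (Suc s) j * w j) + h * \<alpha> (Suc s) (Suc s) * w (Suc s)" for z w
    by (simp add: algebra_simps)
  ultimately show ?thesis
    unfolding substep_stages_def by (simp only: ball_simps(7) conj_ac)
qed

lemma substep_stages_cong:
  assumes "\<And>i. i \<le> s \<Longrightarrow> u i = u' i" "\<And>i. i \<le> s \<Longrightarrow> v i = v' i" "\<And>i. i \<le> s \<Longrightarrow> a i = a' i"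
  shows "substep_stages s \<gamma> \<alpha> \<xi> \<omega> f t h x u v a \<longleftrightarrow> substep_stages s \<gamma> \<alpha> \<xi> \<omega> f t h x u' v' a'"
proof -
  have "(\<Sum>j\<le>i. \<alpha> i j * v j) = (\<Sum>j\<le>i. \<alpha> i j * v' j)"
    "(\<Sum>j\<le>i. \<alpha> i j * a j) = (\<Sum>j\<le>i. \<alpha> i j * a' j)" if "i \<in> {1..s}" for i
    using that assms by (auto intro!: sum.cong)
  then show ?thesis
    unfolding substep_stages_def using assms by auto
qed

lemma substep_stages_ex:
  assumes "\<bar>\<xi>\<bar> < 1"
  shows "\<exists>u v a. substep_stages s \<gamma> \<alpha> \<xi> \<omega> f t h x u v a"
proof (induction s)
  case 0
  show ?case
    by (rule exI[of _ "\<lambda>_. x $ 0"], rule exI[of _ "\<lambda>_. x $ 1"],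
        rule exI[of _ "\<lambda>_. f t - 2 * \<xi> * \<omega> * x $ 1 - \<omega>\<^sup>2 * x $ 0"])
      (simp add: substep_stages_def)
next
  case (Suc s)
  then obtain u v a where st: "substep_stages s \<gamma> \<alpha> \<xi> \<omega> f t h x u v a" by blast
  let ?k = "h * \<alpha> (Suc s) (Suc s)"
  let ?U = "u 0 + h * (\<Sum>j\<le>s. \<alpha> (Suc s) j * v j)"
  let ?V = "v 0 + h * (\<Sum>j\<le>s. \<alpha> (Suc s) j * a j)"
  let ?F = "f (t + \<gamma> (Suc s) * h)"
  define a1 where
    "a1 = (?F - 2 * \<xi> * \<omega> * ?V - \<omega>\<^sup>2 * (?U + ?k * ?V)) / (1 + 2 * \<xi> * \<omega> * ?k + \<omega>\<^sup>2 * ?k\<^sup>2)"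
  define v1 where "v1 = ?V + ?k * a1"
  define u1 where "u1 = ?U + ?k * v1"
  let ?u = "u(Suc s := u1)" and ?v = "v(Suc s := v1)" and ?a = "a(Suc s := a1)"
  have "substep_stages s \<gamma> \<alpha> \<xi> \<omega> f t h x ?u ?v ?a"
    using st substep_stages_cong[of s u ?u v ?v a ?a] by simp
  moreover have "(\<Sum>j\<le>s. \<alpha> (Suc s) j * ?v j) = (\<Sum>j\<le>s. \<alpha> (Suc s) j * v j)"
    "(\<Sum>j\<le>s. \<alpha> (Suc s) j * ?a j) = (\<Sum>j\<le>s. \<alpha> (Suc s) j * a j)"
    "?u 0 = u 0" "?v 0 = v 0"
    by (auto intro!: sum.cong)
  moreover have "a1 + 2 * \<xi> * \<omega> * v1 + \<omega>\<^sup>2 * u1 = ?F \<and> u1 = ?U + ?k * v1 \<and> v1 = ?V + ?k * a1"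
    by (subst stage_system_iff[OF assms]) (simp only: a1_def v1_def u1_def simp_thms)
  ultimately have "substep_stages (Suc s) \<gamma> \<alpha> \<xi> \<omega> f t h x ?u ?v ?a"
    unfolding substep_stages_Suc fun_upd_same by metis
  then show ?case by blast
qed

lemma substep_stages_unique:
  assumes "\<bar>\<xi>\<bar> < 1"
    and "substep_stages s \<gamma> \<alpha> \<xi> \<omega> f t h x u v a" "substep_stages s \<gamma> \<alpha> \<xi> \<omega> f t h x u' v' a'"
  shows "\<forall>i\<le>s. u i = u' i \<and> v i = v' i \<and> a i = a' i"
  using assms(2,3)
proof (induction s)
  case 0
  then show ?case by (auto simp: substep_stages_def)
next
  case (Suc s)
  have "substep_stages s \<gamma> \<alpha> \<xi> \<omega> f t h x u v a"
    "substep_stages s \<gamma> \<alpha> \<xi> \<omega> f t h x u' v' a'"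
    using Suc.prems unfolding substep_stages_Suc by blast+
  from Suc.IH[OF this] have IH: "\<forall>i\<le>s. u i = u' i \<and> v i = v' i \<and> a i = a' i" .
  then have eqs: "u 0 = u' 0" "v 0 = v' 0"
    "(\<Sum>j\<le>s. \<alpha> (Suc s) j * v j) = (\<Sum>j\<le>s. \<alpha> (Suc s) j * v' j)"
    "(\<Sum>j\<le>s. \<alpha> (Suc s) j * a j) = (\<Sum>j\<le>s. \<alpha> (Suc s) j * a' j)"
    by (auto intro!: sum.cong)
  have "u (Suc s) = u' (Suc s) \<and> v (Suc s) = v' (Suc s) \<and> a (Suc s) = a' (Suc s)"
    using Suc.prems unfolding substep_stages_Suc stage_system_iff[OF assms(1)] eqs by metis
  with IH show ?case by (auto simp: le_Suc_eq)
qed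

lemma num_step_eq:
  assumes "\<bar>\<xi>\<bar> < 1" and "substep_stages s \<gamma> \<alpha> \<xi> \<omega> f t h x u v a"
  shows "num_step s \<gamma> \<alpha> \<xi> \<omega> f t h x = vec_of_list [u s, v s]"
  unfolding num_step_def
proof (rule the_equality)
  show "\<exists>u' v' a'. substep_stages s \<gamma> \<alpha> \<xi> \<omega> f t h x u' v' a' \<and>
      vec_of_list [u s, v s] = vec_of_list [u' s, v' s]"
    using assms(2) by blast
next
  fix y
  assume "\<exists>u v a. substep_stages s \<gamma> \<alpha> \<xi> \<omega> f t h x u v a \<and> y = vec_of_list [u s, v s]"
  then obtain u' v' a' where "substep_stages s \<gamma> \<alpha> \<xi> \<omega> f t h x u' v' a'"
    and y: "y = vec_of_list [u' s, v' s]" by blast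
  from substep_stages_unique[OF assms(1) this(1) assms(2)]
  show "y = vec_of_list [u s, v s]" unfolding y by simp
qed

lemma substep_stages_lincomb:
  assumes "substep_stages s \<gamma> \<alpha> \<xi> \<omega> f t h x u v a" "substep_stages s \<gamma> \<alpha> \<xi> \<omega> g t h y u' v' a'"
  shows "substep_stages s \<gamma> \<alpha> \<xi> \<omega> (\<lambda>t. f t + c * g t) t h
    (vec_of_list [x $ 0 + c * y $ 0, x $ 1 + c * y $ 1])
    (\<lambda>i. u i + c * u' i) (\<lambda>i. v i + c * v' i) (\<lambda>i. a i + c * a' i)"
proof -
  have lin: "p + c * p' + 2 * \<xi> * \<omega> * (q + c * q') + \<omega>\<^sup>2 * (r + c * r') =
      (p + 2 * \<xi> * \<omega> * q + \<omega>\<^sup>2 * r) + c * (p' + 2 * \<xi> * \<omega> * q' + \<omega>\<^sup>2 * r')" for p p' q q' r r'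
    by (simp add: algebra_simps)
  have sum: "z + c * z' + h * (\<Sum>j\<le>i. \<alpha> i j * (w j + c * w' j)) =
      (z + h * (\<Sum>j\<le>i. \<alpha> i j * w j)) + c * (z' + h * (\<Sum>j\<le>i. \<alpha> i j * w' j))" for z z' w w' i
  proof -
    have "(\<Sum>j\<le>i. \<alpha> i j * (w j + c * w' j)) =
        (\<Sum>j\<le>i. \<alpha> i j * w j) + c * (\<Sum>j\<le>i. \<alpha> i j * w' j)"
      unfolding sum_distrib_left sum.distrib[symmetric]
      by (rule sum.cong) (simp_all add: algebra_simps)
    then show ?thesis by (simp add: algebra_simps)
  qed
  note D1 = assms(1)[unfolded substep_stages_def] and D2 = assms(2)[unfolded substep_stages_def]
  have init: "u 0 = x $ 0" "v 0 = x $ 1" "a 0 + 2 * \<xi> * \<omega> * v 0 + \<omega>\<^sup>2 * u 0 = f t"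
    using D1 by auto
  have init': "u' 0 = y $ 0" "v' 0 = y $ 1" "a' 0 + 2 * \<xi> * \<omega> * v' 0 + \<omega>\<^sup>2 * u' 0 = g t"
    using D2 by auto
  have ic: "u 0 + c * u' 0 = vec_of_list [x $ 0 + c * y $ 0, x $ 1 + c * y $ 1] $ 0"
    "v 0 + c * v' 0 = vec_of_list [x $ 0 + c * y $ 0, x $ 1 + c * y $ 1] $ 1"
    by (simp_all add: init(1,2) init'(1,2) del: vec_of_list_Cons add: vec_of_list_index)
  have ac: "a 0 + c * a' 0 =
      f t + c * g t - 2 * \<xi> * \<omega> * (v 0 + c * v' 0) - \<omega>\<^sup>2 * (u 0 + c * u' 0)"
    using lin[of "a 0" "a' 0" "v 0" "v' 0" "u 0" "u' 0"] unfolding init(3) init'(3) by linarith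
  have st: "a i + c * a' i + 2 * \<xi> * \<omega> * (v i + c * v' i) + \<omega>\<^sup>2 * (u i + c * u' i) =
        f (t + \<gamma> i * h) + c * g (t + \<gamma> i * h) \<and>
      u i + c * u' i = u 0 + c * u' 0 + h * (\<Sum>j\<le>i. \<alpha> i j * (v j + c * v' j)) \<and>
      v i + c * v' i = v 0 + c * v' 0 + h * (\<Sum>j\<le>i. \<alpha> i j * (a j + c * a' j))"
    if "i \<in> {1..s}" for i
  proof -
    have e: "a i + 2 * \<xi> * \<omega> * v i + \<omega>\<^sup>2 * u i = f (t + \<gamma> i * h)"
      "u 0 + h * (\<Sum>j\<le>i. \<alpha> i j * v j) = u i" "v 0 + h * (\<Sum>j\<le>i. \<alpha> i j * a j) = v i"
      using D1 that by metis+
    have e': "a' i + 2 * \<xi> * \<omega> * v' i + \<omega>\<^sup>2 * u' i = g (t + \<gamma> i * h)"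
      "u' 0 + h * (\<Sum>j\<le>i. \<alpha> i j * v' j) = u' i" "v' 0 + h * (\<Sum>j\<le>i. \<alpha> i j * a' j) = v' i"
      using D2 that by metis+
    show ?thesis unfolding lin sum e e' by simp
  qed
  show ?thesis
    unfolding substep_stages_def using ic ac st by blast
qed

lemma one_list_index: "[a, b] ! 1 = b"
  by simp

lemma num_step_affine_ex:
  assumes "\<bar>\<xi>\<bar> < 1"
  shows "\<exists>D\<in>carrier_mat 2 2. \<forall>f t. \<exists>L\<in>carrier_vec 2. \<forall>x\<in>carrier_vec 2.
    num_step s \<gamma> \<alpha> \<xi> \<omega> f t h x = D *\<^sub>v x + L"
proof -
  let ?S = "substep_stages s \<gamma> \<alpha> \<xi> \<omega>"
  obtain u1 v1 a1 where 1: "?S (\<lambda>_. 0) 0 h (vec_of_list [1, 0]) u1 v1 a1"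
    using substep_stages_ex[OF assms, of s \<gamma> \<alpha> \<omega> "\<lambda>_. 0" 0 h "vec_of_list [1, 0]"] by metis
  obtain u2 v2 a2 where 2: "?S (\<lambda>_. 0) 0 h (vec_of_list [0, 1]) u2 v2 a2"
    using substep_stages_ex[OF assms, of s \<gamma> \<alpha> \<omega> "\<lambda>_. 0" 0 h "vec_of_list [0, 1]"] by metis
  define D where "D = mat_of_rows_list 2 [[u1 s, u2 s], [v1 s, v2 s]]"
  have D: "D \<in> carrier_mat 2 2"
    unfolding D_def by (simp add: mat_of_rows_list_def numeral_2_eq_2)
  have Dx: "D *\<^sub>v vec_of_list [p, q] = vec_of_list [u1 s * p + u2 s * q, v1 s * p + v2 s * q]" for p q
    unfolding mult_mat_vec_of_list_2[OF D] by (simp add: D_def mat_of_rows_list_def)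
  have "\<exists>L\<in>carrier_vec 2. \<forall>x\<in>carrier_vec 2. num_step s \<gamma> \<alpha> \<xi> \<omega> f t h x = D *\<^sub>v x + L" for f t
  proof -
    have 1: "?S (\<lambda>_. 0) t h (vec_of_list [1, 0]) u1 v1 a1"
      using 1 by (unfold substep_stages_def)
    have 2: "?S (\<lambda>_. 0) t h (vec_of_list [0, 1]) u2 v2 a2"
      using 2 by (unfold substep_stages_def)
    obtain u0 v0 a0 where 0: "?S f t h (vec_of_list [0, 0]) u0 v0 a0"
      using substep_stages_ex[OF assms, of s \<gamma> \<alpha> \<omega> "f" t h "vec_of_list [0, 0]"] by metis
    have "num_step s \<gamma> \<alpha> \<xi> \<omega> f t h x = D *\<^sub>v x + vec_of_list [u0 s, v0 s]"
      if xc: "x \<in> carrier_vec 2" for x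
    proof -
      obtain p q where x: "x = vec_of_list [p, q]" using carrier_vec_2_eq[OF xc] by blast
      have "?S (\<lambda>t. f t + p * 0) t h (vec_of_list [p, 0])
          (\<lambda>i. u0 i + p * u1 i) (\<lambda>i. v0 i + p * v1 i) (\<lambda>i. a0 i + p * a1 i)"
        using substep_stages_lincomb[OF 0 1, of p]
        by (simp only: vec_of_list_index nth_Cons_0 one_list_index
              mult_1_right mult_zero_right add_0_left)
      from substep_stages_lincomb[OF this 2, of q]
      have "?S f t h x (\<lambda>i. u0 i + p * u1 i + q * u2 i)
          (\<lambda>i. v0 i + p * v1 i + q * v2 i) (\<lambda>i. a0 i + p * a1 i + q * a2 i)"
        unfolding x
        by (simp only: vec_of_list_index nth_Cons_0 one_list_index
              mult_1_right mult_zero_right add_0_left add_0_right)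
      from num_step_eq[OF assms this] show ?thesis
        unfolding x Dx vec_of_list_2_add by (simp add: algebra_simps del: vec_of_list_Cons)
    qed
    then have "\<forall>x\<in>carrier_vec 2. num_step s \<gamma> \<alpha> \<xi> \<omega> f t h x = D *\<^sub>v x + vec_of_list [u0 s, v0 s]"
      by (rule ballI)
    then show ?thesis by (rule bexI[OF _ vec_of_list_2_carrier])
  qed
  then show ?thesis by (intro bexI[OF _ D] allI)
qed

lemma num_step_affine_unique:
  fixes D E :: "real mat" and L M :: "real vec"
  assumes "D \<in> carrier_mat 2 2" "E \<in> carrier_mat 2 2" "L \<in> carrier_vec 2" "M \<in> carrier_vec 2"
    and eq: "\<And>x. x \<in> carrier_vec 2 \<Longrightarrow> D *\<^sub>v x + L = E *\<^sub>v x + M"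
  shows "D = E" "L = M"
proof -
  have z: "A *\<^sub>v 0\<^sub>v 2 = 0\<^sub>v 2" if "A \<in> carrier_mat 2 2" for A :: "real mat"
    using that by (intro eq_vecI) auto
  show L: "L = M" using eq[of "0\<^sub>v 2"] assms(1-4) by (simp add: z)
  show "D = E"
  proof (rule mat_2_eqI[OF assms(1,2)])
    fix x :: "real vec" assume x: "x \<in> carrier_vec 2"
    have c: "D *\<^sub>v x \<in> carrier_vec 2" "E *\<^sub>v x \<in> carrier_vec 2"
      using assms(1,2) x by auto
    show "D *\<^sub>v x = E *\<^sub>v x"
    proof (intro eq_vecI)
      fix i assume "i < dim_vec (E *\<^sub>v x)"
      then have i: "i < 2" using assms(2) by simp
      from arg_cong[OF eq[OF x], of "\<lambda>w. w $ i"] show "(D *\<^sub>v x) $ i = (E *\<^sub>v x) $ i"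
        using c i assms(3,4) unfolding L by (simp add: index_add_vec)
    qed (use assms(1,2) in simp)
  qed
qed

lemma num_step_affine:
  assumes "\<bar>\<xi>\<bar> < 1"
  shows "D_num s \<gamma> \<alpha> \<xi> \<omega> h \<in> carrier_mat 2 2" "L_num s \<gamma> \<alpha> \<xi> \<omega> f t h \<in> carrier_vec 2"
    "x \<in> carrier_vec 2 \<Longrightarrow>
       num_step s \<gamma> \<alpha> \<xi> \<omega> f t h x = D_num s \<gamma> \<alpha> \<xi> \<omega> h *\<^sub>v x + L_num s \<gamma> \<alpha> \<xi> \<omega> f t h"
proof -
  let ?P = "\<lambda>D. D \<in> carrier_mat 2 2 \<and> (\<forall>f t. \<exists>L\<in>carrier_vec 2. \<forall>x\<in>carrier_vec 2.
    num_step s \<gamma> \<alpha> \<xi> \<omega> f t h x = D *\<^sub>v x + L)"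
  have "\<exists>!D. ?P D"
  proof (rule ex_ex1I)
    show "\<exists>D. ?P D" using num_step_affine_ex[OF assms] by blast
  next
    fix D E assume DE: "?P D" "?P E"
    obtain L M where "L \<in> carrier_vec 2" "M \<in> carrier_vec 2"
      "\<forall>x\<in>carrier_vec 2. num_step s \<gamma> \<alpha> \<xi> \<omega> (\<lambda>_. 0) 0 h x = D *\<^sub>v x + L"
      "\<forall>x\<in>carrier_vec 2. num_step s \<gamma> \<alpha> \<xi> \<omega> (\<lambda>_. 0) 0 h x = E *\<^sub>v x + M"
      using DE by meson
    then show "D = E" using DE by (intro num_step_affine_unique(1)[of D E L M]) auto
  qed
  from theI'[OF this] have D: "?P (D_num s \<gamma> \<alpha> \<xi> \<omega> h)" unfolding D_num_def .
  then show D2: "D_num s \<gamma> \<alpha> \<xi> \<omega> h \<in> carrier_mat 2 2" by blast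
  let ?Q = "\<lambda>L. L \<in> carrier_vec 2 \<and>
    (\<forall>x\<in>carrier_vec 2. num_step s \<gamma> \<alpha> \<xi> \<omega> f t h x = D_num s \<gamma> \<alpha> \<xi> \<omega> h *\<^sub>v x + L)"
  have "\<exists>!L. ?Q L"
  proof (rule ex_ex1I)
    show "\<exists>L. ?Q L" using D by blast
  next
    fix L M assume "?Q L" "?Q M"
    then show "L = M" using D2
      by (intro num_step_affine_unique(2)[of "D_num s \<gamma> \<alpha> \<xi> \<omega> h" "D_num s \<gamma> \<alpha> \<xi> \<omega> h" L M]) auto
  qed
  from theI'[OF this] have L: "?Q (L_num s \<gamma> \<alpha> \<xi> \<omega> f t h)" unfolding L_num_def .
  then show "L_num s \<gamma> \<alpha> \<xi> \<omega> f t h \<in> carrier_vec 2" by blast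
  show "x \<in> carrier_vec 2 \<Longrightarrow>
    num_step s \<gamma> \<alpha> \<xi> \<omega> f t h x = D_num s \<gamma> \<alpha> \<xi> \<omega> h *\<^sub>v x + L_num s \<gamma> \<alpha> \<xi> \<omega> f t h"
    using L by blast
qed

lemma exact_solution_lincomb:
  assumes "exact_solution \<xi> \<omega> f u v" "exact_solution \<xi> \<omega> g u' v'"
  shows "exact_solution \<xi> \<omega> (\<lambda>t. f t + c * g t) (\<lambda>t. u t + c * u' t) (\<lambda>t. v t + c * v' t)"
  using assms unfolding exact_solution_def
  by (auto intro!: derivative_eq_intros simp: algebra_simps)

lemma exact_solution_zero:
  assumes "\<xi> \<ge> 0" "\<omega> > 0" and sol: "exact_solution \<xi> \<omega> (\<lambda>_. 0) u v"
    and "u 0 = 0" "v 0 = 0" and "h \<ge> 0"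
  shows "u h = 0" "v h = 0"
proof -
  define W where "W t = (v t)\<^sup>2 + \<omega>\<^sup>2 * (u t)\<^sup>2" for t
  have W': "(W has_real_derivative - (4 * \<xi> * \<omega> * (v t)\<^sup>2)) (at t)" for t
    using sol unfolding exact_solution_def W_def
    by (auto intro!: derivative_eq_intros simp: algebra_simps power2_eq_square)
  have "W h \<le> W 0"
  proof (rule DERIV_nonpos_imp_nonincreasing[OF \<open>h \<ge> 0\<close>])
    fix t
    show "\<exists>y. (W has_real_derivative y) (at t) \<and> y \<le> 0"
      using W'[of t] assms(1,2) by (intro exI conjI) auto
  qed
  then have "W h \<le> 0" using assms(4,5) by (simp add: W_def)
  then have "(v h)\<^sup>2 + (\<omega> * u h)\<^sup>2 \<le> 0" by (simp add: W_def power_mult_distrib)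
  then have "v h = 0 \<and> \<omega> * u h = 0" by (simp add: sum_power2_le_zero_iff)
  then show "u h = 0" "v h = 0" using \<open>\<omega> > 0\<close> by auto
qed

lemma exact_solution_unique:
  assumes "\<xi> \<ge> 0" "\<omega> > 0" "exact_solution \<xi> \<omega> f u v" "exact_solution \<xi> \<omega> f u' v'"
    and "u 0 = u' 0" "v 0 = v' 0" and "h \<ge> 0"
  shows "u h = u' h" "v h = v' h"
  using exact_solution_zero[OF assms(1,2) exact_solution_lincomb[OF assms(3,4), of "-1", simplified]]
    assms(5-7) by auto

lemma exact_solution_hom_ex:
  assumes "\<xi> \<in> {0..<1}" "\<omega> > 0"
  shows "\<exists>u v. exact_solution \<xi> \<omega> (\<lambda>_. 0) u v \<and> u 0 = p \<and> v 0 = q"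
proof -
  define c where "c = \<xi> * \<omega>"
  define d where "d = \<omega> * sqrt (1 - \<xi>\<^sup>2)"
  have \<xi>: "1 - \<xi>\<^sup>2 > 0" using assms(1) by (simp add: abs_square_less_1)
  then have d: "d > 0" using assms(2) by (simp add: d_def)
  have \<omega>2: "\<omega>\<^sup>2 = c\<^sup>2 + d\<^sup>2"
    using \<xi> by (simp add: c_def d_def power_mult_distrib) (simp add: algebra_simps)
  define B where "B = (q + c * p) / d"
  define u where "u t = exp (- c * t) * (p * cos (d * t) + B * sin (d * t))" for t
  define v where
    "v t = exp (- c * t) * ((d * B - c * p) * cos (d * t) - (c * B + d * p) * sin (d * t))" for t
  have "(u has_real_derivative v t) (at t)" for t
    unfolding u_def v_def by (auto intro!: derivative_eq_intros simp: algebra_simps)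
  moreover have "(v has_real_derivative 0 - 2 * \<xi> * \<omega> * v t - \<omega>\<^sup>2 * u t) (at t)" for t
  proof -
    have "(v has_real_derivative - 2 * c * v t - (c\<^sup>2 + d\<^sup>2) * u t) (at t)"
      unfolding u_def v_def
      by (auto intro!: derivative_eq_intros simp: algebra_simps power2_eq_square)
    then show ?thesis by (simp add: \<omega>2 c_def mult.assoc)
  qed
  ultimately have "exact_solution \<xi> \<omega> (\<lambda>_. 0) u v" by (simp add: exact_solution_def)
  moreover have "u 0 = p" "v 0 = q" using d by (auto simp: u_def v_def B_def)
  ultimately show ?thesis by blast
qed

lemma exact_solution_exp_ex:
  assumes "\<xi> \<in> {0..<1}" "\<omega> > 0"
  shows "\<exists>u v. exact_solution \<xi> \<omega> exp u v \<and> u 0 = p \<and> v 0 = q"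
proof -
  define K where "K = 1 + 2 * \<xi> * \<omega> + \<omega>\<^sup>2"
  have "K > 0" using assms by (auto simp: K_def intro!: add_pos_nonneg)
  then have *: "x / K + 2 * \<xi> * \<omega> * (x / K) + \<omega>\<^sup>2 * (x / K) = x" for x
  proof -
    have "x / K + 2 * \<xi> * \<omega> * (x / K) + \<omega>\<^sup>2 * (x / K) = x / K * K"
      unfolding K_def by (simp only: algebra_simps)
    then show ?thesis using \<open>K > 0\<close> by simp
  qed
  have part: "exact_solution \<xi> \<omega> exp (\<lambda>t. exp t / K) (\<lambda>t. exp t / K)"
    unfolding exact_solution_def
    using *[of "exp _"] by (auto intro!: derivative_eq_intros simp: algebra_simps)
  obtain u v where "exact_solution \<xi> \<omega> (\<lambda>_. 0) u v" "u 0 = p - 1 / K" "v 0 = q - 1 / K"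
    using exact_solution_hom_ex[OF assms] by blast
  with exact_solution_lincomb[OF part, of "\<lambda>_. 0" u v 1] show ?thesis
    by (intro exI[of _ "\<lambda>t. exp t / K + u t"] exI[of _ "\<lambda>t. exp t / K + v t"]) simp
qed

lemma D_exa:
  assumes "\<xi> \<in> {0..<1}" "\<omega> > 0" "h \<ge> 0"
  shows "D_exa \<xi> \<omega> h \<in> carrier_mat 2 2"
    "exact_solution \<xi> \<omega> (\<lambda>_. 0) u v \<Longrightarrow>
       vec_of_list [u h, v h] = D_exa \<xi> \<omega> h *\<^sub>v vec_of_list [u 0, v 0]"
proof -
  let ?P = "\<lambda>D. D \<in> carrier_mat 2 2 \<and> (\<forall>u v. exact_solution \<xi> \<omega> (\<lambda>_. 0) u v \<longrightarrow>
    vec_of_list [u h, v h] = D *\<^sub>v vec_of_list [u 0, v 0])"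
  have "\<exists>!D. ?P D"
  proof (rule ex_ex1I)
    obtain u1 v1 where 1: "exact_solution \<xi> \<omega> (\<lambda>_. 0) u1 v1" "u1 0 = 1" "v1 0 = 0"
      using exact_solution_hom_ex[OF assms(1,2)] by blast
    obtain u2 v2 where 2: "exact_solution \<xi> \<omega> (\<lambda>_. 0) u2 v2" "u2 0 = 0" "v2 0 = 1"
      using exact_solution_hom_ex[OF assms(1,2)] by blast
    define D where "D = mat_of_rows_list 2 [[u1 h, u2 h], [v1 h, v2 h]]"
    have D: "D \<in> carrier_mat 2 2"
      unfolding D_def by (simp add: mat_of_rows_list_def numeral_2_eq_2)
    have "vec_of_list [u h, v h] = D *\<^sub>v vec_of_list [u 0, v 0]"
      if "exact_solution \<xi> \<omega> (\<lambda>_. 0) u v" for u v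
    proof -
      have "exact_solution \<xi> \<omega> (\<lambda>_. 0)
          (\<lambda>t. 0 + u 0 * u1 t + v 0 * u2 t) (\<lambda>t. 0 + u 0 * v1 t + v 0 * v2 t)"
        using exact_solution_lincomb[OF exact_solution_lincomb[OF _ 1(1), of "\<lambda>_. 0" "\<lambda>_. 0" "\<lambda>_. 0" "u 0"]
            2(1), of "v 0"]
        by (simp add: exact_solution_def)
      from exact_solution_unique[OF _ assms(2) that this _ _ assms(3)] assms(1) 1 2
      show ?thesis
        unfolding mult_mat_vec_of_list_2[OF D] vec_of_list_2_eq_iff
        by (simp add: D_def mat_of_rows_list_def mult.commute)
    qed
    with D show "\<exists>D. ?P D" by blast
  next
    fix D E assume DE: "?P D" "?P E"
    show "D = E"
    proof (rule mat_2_eqI)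
      fix x :: "real vec" assume "x \<in> carrier_vec 2"
      then obtain p q where x: "x = vec_of_list [p, q]" using carrier_vec_2_eq by blast
      obtain u v where "exact_solution \<xi> \<omega> (\<lambda>_. 0) u v" "u 0 = p" "v 0 = q"
        using exact_solution_hom_ex[OF assms(1,2)] by blast
      with DE show "D *\<^sub>v x = E *\<^sub>v x" unfolding x by metis
    qed (use DE in auto)
  qed
  from theI'[OF this] have D: "?P (D_exa \<xi> \<omega> h)" unfolding D_exa_def .
  then show "D_exa \<xi> \<omega> h \<in> carrier_mat 2 2" by blast
  show "exact_solution \<xi> \<omega> (\<lambda>_. 0) u v \<Longrightarrow>
    vec_of_list [u h, v h] = D_exa \<xi> \<omega> h *\<^sub>v vec_of_list [u 0, v 0]"
    using D by blast
qed

lemma L_exa: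
  assumes "\<xi> \<in> {0..<1}" "\<omega> > 0" "h \<ge> 0"
    and "exact_solution \<xi> \<omega> exp u v" "u 0 = 0" "v 0 = 0"
  shows "L_exa \<xi> \<omega> h = vec_of_list [u h, v h]"
  unfolding L_exa_def
proof (rule the_equality)
  show "\<exists>u' v'. exact_solution \<xi> \<omega> exp u' v' \<and> u' 0 = 0 \<and> v' 0 = 0 \<and>
      vec_of_list [u h, v h] = vec_of_list [u' h, v' h]"
    using assms by blast
next
  fix L
  assume "\<exists>u v. exact_solution \<xi> \<omega> exp u v \<and> u 0 = 0 \<and> v 0 = 0 \<and> L = vec_of_list [u h, v h]"
  then obtain u' v' where "exact_solution \<xi> \<omega> exp u' v'" "u' 0 = 0" "v' 0 = 0"
    "L = vec_of_list [u' h, v' h]" by blast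
  then show "L = vec_of_list [u h, v h]"
    using exact_solution_unique[OF _ assms(2) _ assms(4) _ _ assms(3), of u' v'] assms by simp
qed

end

theory Submission
  imports Defs
begin

text \<open>The idea is to work with one complex number instead of the real pair (displacement, velocity).
  For \<open>\<omega> > 0\<close> and \<open>0 \<le> \<xi> < 1\<close> the companion matrix of the test equation has an eigenvalue \<open>l\<close> that is not real, and
  the pairing \<open>z\<close> of the state with the corresponding left eigenvector determines the state. In this
  coordinate the equation reads \<open>z' = l z + f\<close>, and the method is a diagonally implicit Runge-Kutta
  method for this scalar equation (\<open>stages_modal\<close>). Without load, one step is multiplication by a
  complex number \<open>w\<close>, and the amplification matrix is the real matrix \<open>modal_mat l w\<close> of this
  multiplication; it has trace \<open>2 Re w\<close> and determinant \<open>|w|\<^sup>2\<close>, and its eigenvalues are \<open>w\<close> and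
  \<open>cnj w\<close>.

  Accuracy is a statement about general methods (\<open>third_order_accurate\<close>): the classical conditions up
  to order three suffice. The implicit stages are expanded in powers of the step size by a fixed-point
  iteration that gains one power each time (\<open>stage_refine\<close>), and the result is compared with the
  Taylor polynomial of the exact solution, which is a combination of exponentials in the modal
  coordinate.

  For the method at hand, \<open>w\<close> is a rational function of \<open>Z = h l\<close> with a triple pole and a cubic
  numerator (\<open>suci3_amplification\<close>). It depends on \<open>\<gamma>1\<close> only and tends to \<open>R_inf \<gamma>1\<close> as \<open>Z\<close> tends to
  infinity. Since \<open>|l| = \<omega>\<close>, this one limit yields both the limit of the characteristic polynomial
  and the behaviour after the first step. Without damping \<open>l\<close> is imaginary, and stability means
  \<open>|w| \<le> 1\<close> on the imaginary axis. Because of the order conditions, the difference of the squared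
  moduli of denominator and numerator has only terms of degree four and six
  (\<open>suci3_amp_imag_le_1_iff\<close>); nonnegativity of their coefficients is the stability criterion. What
  remains is to locate the roots of explicit cubics (\<open>suci3_stability_limit\<close>) and an application of
  the intermediate value theorem to \<open>R_inf\<close>.\<close>

section \<open>Order three for scalar linear equations\<close>

text \<open>The tail of the exponential series is compared with \<open>norm z ^ Suc n\<close> times the whole
  series, using \<open>fact k \<le> fact (k + n + 1)\<close>.\<close>

lemma exp_taylor_bound:
  fixes z :: complex
  shows "norm (exp z - (\<Sum>k\<le>n. z ^ k / fact k)) \<le> norm z ^ Suc n * exp (norm z)"
proof -
  have sm: "summable (\<lambda>k. norm z ^ k /\<^sub>R fact k)" by (rule summable_exp_generic)
  have le: "norm (z ^ (k + Suc n) /\<^sub>R fact (k + Suc n)) \<le> norm z ^ Suc n * (norm z ^ k /\<^sub>R fact k)" for k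
  proof -
    have "inverse (fact (k + Suc n)) \<le> inverse (fact k :: real)"
      by (intro le_imp_inverse_le fact_mono) auto
    then have "norm z ^ (k + Suc n) * inverse (fact (k + Suc n)) \<le> norm z ^ (k + Suc n) * inverse (fact k)"
      by (rule mult_left_mono) simp
    moreover have "norm (z ^ (k + Suc n) /\<^sub>R fact (k + Suc n)) =
        norm z ^ (k + Suc n) * inverse (fact (k + Suc n))"
      by (simp add: norm_power del: power_Suc fact_Suc add_Suc_right)
    moreover have "norm z ^ (k + Suc n) * inverse (fact k) = norm z ^ Suc n * (norm z ^ k /\<^sub>R fact k)"
      by (simp only: power_add real_scaleR_def mult_ac)
    ultimately show ?thesis by (simp only:)
  qed
  have sn: "summable (\<lambda>k. norm (z ^ (k + Suc n) /\<^sub>R fact (k + Suc n)))"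
    by (rule summable_comparison_test[OF _ summable_mult[OF sm, of "norm z ^ Suc n"]]) (use le in auto)
  have "exp z - (\<Sum>k\<le>n. z ^ k / fact k) = (\<Sum>k. z ^ (k + Suc n) /\<^sub>R fact (k + Suc n))"
    unfolding exp_def suminf_minus_initial_segment[OF summable_exp_generic]
    by (simp only: lessThan_Suc_atMost) (simp add: scaleR_conv_of_real field_simps)
  also have "norm \<dots> \<le> (\<Sum>k. norm (z ^ (k + Suc n) /\<^sub>R fact (k + Suc n)))"
    by (rule summable_norm[OF sn])
  also have "\<dots> \<le> (\<Sum>k. norm z ^ Suc n * (norm z ^ k /\<^sub>R fact k))"
    by (rule suminf_le[OF le sn summable_mult[OF sm]])
  also have "\<dots> = norm z ^ Suc n * exp (norm z)"
    unfolding exp_def by (rule suminf_mult[OF sm])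
  finally show ?thesis .
qed

lemma exp_taylor_bigo:
  fixes c :: complex
  shows "(\<lambda>h. exp (of_real h * c) - (\<Sum>k\<le>n. (of_real h * c) ^ k / fact k))
           \<in> O[at_right (0::real)](\<lambda>h. of_real h ^ Suc n)"
proof (rule bigoI[where c = "norm c ^ Suc n * exp (norm c)"])
  have "eventually (\<lambda>h::real. h \<in> {0<..<1}) (at_right 0)"
    by (rule eventually_at_right_real) simp
  then show "eventually (\<lambda>h. norm (exp (of_real h * c) - (\<Sum>k\<le>n. (of_real h * c) ^ k / fact k))
      \<le> norm c ^ Suc n * exp (norm c) * norm (of_real h ^ Suc n :: complex)) (at_right 0)"
  proof eventually_elim
    case (elim h)
    have "norm (exp (of_real h * c) - (\<Sum>k\<le>n. (of_real h * c) ^ k / fact k))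
        \<le> norm (of_real h * c) ^ Suc n * exp (norm (of_real h * c))"
      by (rule exp_taylor_bound)
    also have "\<dots> \<le> norm (of_real h * c) ^ Suc n * exp (norm c)"
      using elim by (intro mult_left_mono) (auto simp: norm_mult intro: mult_left_le_one_le)
    also have "\<dots> = norm c ^ Suc n * exp (norm c) * norm (of_real h ^ Suc n :: complex)"
      by (simp add: norm_mult norm_power power_mult_distrib)
    finally show ?case .
  qed
qed

lemma bigo_cmult:
  fixes f :: "real \<Rightarrow> complex"
  shows "f \<in> O[F](g) \<Longrightarrow> (\<lambda>h. c * f h) \<in> O[F](g)"
  by (cases "c = 0") auto

text \<open>For the linear test equation with a load that depends on time only, the elementary
  differentials up to order three give exactly these conditions; the row-sum condition makes the
  remaining trees coincide with them. The condition \<open>\<alpha> 0 0 = 0\<close> encodes that stage 0 is the initial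
  state itself, so that the stage formula holds for all indices including 0.\<close>

definition third_order_conditions ::
  "nat \<Rightarrow> (nat \<Rightarrow> real) \<Rightarrow> (nat \<Rightarrow> nat \<Rightarrow> real) \<Rightarrow> bool" where
  "third_order_conditions s \<gamma> \<alpha> \<longleftrightarrow>
     \<alpha> 0 0 = 0 \<and> (\<forall>i\<le>s. (\<Sum>j\<le>i. \<alpha> i j) = \<gamma> i) \<and> \<gamma> s = 1 \<and>
     (\<Sum>j\<le>s. \<alpha> s j * \<gamma> j) = 1 / 2 \<and> (\<Sum>j\<le>s. \<alpha> s j * (\<gamma> j)\<^sup>2) = 1 / 3 \<and>
     (\<Sum>j\<le>s. \<alpha> s j * (\<Sum>k\<le>j. \<alpha> j k * \<gamma> k)) = 1 / 6"

text \<open>The factor \<open>h\<close> in front of the stage sum turns an expansion of all stages with error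
  \<open>O(h\<^sup>m)\<close> into one with error \<open>O(h\<^sup>m\<^sup>+\<^sup>1)\<close>. Iterating this Picard-like step
  replaces any manipulation of the rational functions that solve the implicit equations.\<close>

lemma stage_refine:
  fixes z F p q :: "real \<Rightarrow> nat \<Rightarrow> complex"
  assumes eq: "\<And>h i. i \<le> s \<Longrightarrow>
      z h i = z0 + of_real h * (\<Sum>j\<le>i. of_real (\<alpha> i j) * (l * z h j + F h j))"
    and "i \<le> s"
    and z: "\<And>j. j \<le> s \<Longrightarrow> (\<lambda>h. z h j - p h j) \<in> O[at_right 0](\<lambda>h. of_real h ^ m)"
    and F: "\<And>j. (\<lambda>h. F h j - q h j) \<in> O[at_right 0](\<lambda>h. of_real h ^ m)"
  shows "(\<lambda>h. z h i - (z0 + of_real h * (\<Sum>j\<le>i. of_real (\<alpha> i j) * (l * p h j + q h j))))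
           \<in> O[at_right 0](\<lambda>h. of_real h ^ Suc m)"
proof -
  have "z h i - (z0 + of_real h * (\<Sum>j\<le>i. of_real (\<alpha> i j) * (l * p h j + q h j))) =
      of_real h * (\<Sum>j\<le>i. of_real (\<alpha> i j) * (l * (z h j - p h j) + (F h j - q h j)))" for h
    unfolding eq[OF \<open>i \<le> s\<close>, of h] by (simp add: algebra_simps sum.distrib sum_subtractf)
  moreover have "(\<lambda>h. \<Sum>j\<le>i. of_real (\<alpha> i j) * (l * (z h j - p h j) + (F h j - q h j)))
      \<in> O[at_right 0](\<lambda>h. of_real h ^ m)"
  proof (rule big_sum_in_bigo)
    fix j assume "j \<in> {..i}"
    then show "(\<lambda>h. of_real (\<alpha> i j) * (l * (z h j - p h j) + (F h j - q h j)))
        \<in> O[at_right 0](\<lambda>h. of_real h ^ m)"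
      using z F \<open>i \<le> s\<close> by (intro bigo_cmult sum_in_bigo(1)) auto
  qed
  ultimately show ?thesis
    unfolding power_Suc by (simp only: landau_o.big.mult_left)
qed

text \<open>This starts the iteration of the previous lemma. Each stage is implicit only in itself, with the
  factor \<open>1 - h \<alpha> i i l\<close>, which tends to 1.\<close>

lemma stages_bounded:
  fixes z F :: "real \<Rightarrow> nat \<Rightarrow> complex"
  assumes eq: "\<And>h i. i \<le> s \<Longrightarrow>
      z h i = z0 + of_real h * (\<Sum>j\<le>i. of_real (\<alpha> i j) * (l * z h j + F h j))"
    and F: "\<And>j. (\<lambda>h. F h j) \<in> O[at_right 0](\<lambda>_. 1)"
    and "i \<le> s"
  shows "(\<lambda>h. z h i) \<in> O[at_right 0](\<lambda>_. 1)"
  using \<open>i \<le> s\<close>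
proof (induction i rule: less_induct)
  case (less i)
  define N where "N h = z0 + of_real h * ((\<Sum>j<i. of_real (\<alpha> i j) * (l * z h j + F h j))
      + of_real (\<alpha> i i) * F h i)" for h
  define d where "d h = 1 - of_real h * of_real (\<alpha> i i) * l" for h :: real
  have zd: "z h i * d h = N h" for h
  proof -
    have "z h i = z0 + of_real h * ((\<Sum>j<i. of_real (\<alpha> i j) * (l * z h j + F h j))
        + of_real (\<alpha> i i) * (l * z h i + F h i))"
      using eq[OF \<open>i \<le> s\<close>, of h] by (simp only: lessThan_Suc_atMost[symmetric] sum.lessThan_Suc)
    then have "z h i - of_real h * of_real (\<alpha> i i) * l * z h i = N h"
      unfolding N_def by (simp only: ring_distribs mult.assoc) (simp only: add_diff_eq diff_eq_eq ac_simps)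
    then show ?thesis unfolding d_def by (simp add: algebra_simps)
  qed
  have h: "(\<lambda>h. of_real h :: complex) \<in> O[at_right 0](\<lambda>_. 1)"
    by (rule bigoI_tendsto[of _ _ 0]) (auto intro!: tendsto_eq_intros)
  have "(\<lambda>h. N h) \<in> O[at_right 0](\<lambda>_. 1)"
  proof -
    have *: "(\<lambda>h. of_real (\<alpha> i j) * (l * z h j + F h j)) \<in> O[at_right 0](\<lambda>_. 1)" if "j < i" for j
      using less.IH[OF that] less.prems that F[of j]
      by (intro bigo_cmult sum_in_bigo(1)) auto
    have "(\<lambda>h. (\<Sum>j<i. of_real (\<alpha> i j) * (l * z h j + F h j)) + of_real (\<alpha> i i) * F h i)
        \<in> O[at_right 0](\<lambda>_. 1)"
      by (rule sum_in_bigo(1)[OF big_sum_in_bigo bigo_cmult[OF F]]) (rule *, simp)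
    from landau_o.big_mult[OF h this] show ?thesis
      unfolding N_def by (intro sum_in_bigo(1)) auto
  qed
  moreover have "(d \<longlongrightarrow> 1) (at_right 0)"
    unfolding d_def by (auto intro!: tendsto_eq_intros)
  then have "((\<lambda>h. inverse (d h)) \<longlongrightarrow> 1) (at_right 0)" "eventually (\<lambda>h. d h \<noteq> 0) (at_right 0)"
    using tendsto_inverse[of d 1] tendsto_imp_eventually_ne[of d 1 _ 0] by auto
  note inv = this
  have "(\<lambda>h. inverse (d h)) \<in> O[at_right 0](\<lambda>_. 1)"
    by (rule bigoI_tendsto[of _ _ 1]) (use inv in auto)
  ultimately have "(\<lambda>h. N h * inverse (d h)) \<in> O[at_right 0](\<lambda>_. 1)"
    using landau_o.big_mult[of N _ "\<lambda>_. 1" "\<lambda>h. inverse (d h)" "\<lambda>_. 1"] by simp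
  moreover have "eventually (\<lambda>h. N h * inverse (d h) = z h i) (at_right 0)"
    using inv(2) by eventually_elim (simp add: zd[symmetric])
  ultimately show ?case by (rule iffD1[OF landau_o.big.in_cong, rotated])
qed

text \<open>Four refinement steps give the Taylor polynomial of degree three of the last stage. The order
  conditions identify it with the Taylor polynomial of the exact solution of
  \<open>z' = l z + \<phi> exp t\<close>, \<open>z(0) = z0\<close>.\<close>

lemma stages_third_order:
  fixes z :: "real \<Rightarrow> nat \<Rightarrow> complex"
  assumes eq: "\<And>h i. i \<le> s \<Longrightarrow> z h i = z0 + of_real h *
      (\<Sum>j\<le>i. of_real (\<alpha> i j) * (l * z h j + \<phi> * exp (of_real (\<gamma> j * h))))"
    and oc: "third_order_conditions s \<gamma> \<alpha>" and "l \<noteq> 1"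
  shows "(\<lambda>h. z h s - (exp (of_real h * l) * z0 + \<phi> * (exp (of_real h) - exp (of_real h * l)) / (1 - l)))
           \<in> O[at_right 0](\<lambda>h. of_real h ^ 4)"
proof -
  define F where "F h j = \<phi> * exp (of_real (\<gamma> j * h))" for h j
  define T where "T n h j = \<phi> * (\<Sum>k\<le>n. (of_real h * of_real (\<gamma> j)) ^ k / fact k)" for n h j
  define \<kappa> where "\<kappa> = l * z0 + \<phi>"
  define g where "g i = complex_of_real (\<gamma> i)" for i
  note eq' = eq[folded F_def]
  have row: "(\<Sum>j\<le>i. of_real (\<alpha> i j)) = g i" if "i \<le> s" for i
    using oc that unfolding third_order_conditions_def g_def of_real_sum[symmetric] by simp
  have FT: "(\<lambda>h. F h j - T n h j) \<in> O[at_right 0](\<lambda>h. of_real h ^ Suc n)" for n j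
  proof -
    have "(\<lambda>h. \<phi> * (exp (of_real h * of_real (\<gamma> j)) -
        (\<Sum>k\<le>n. (of_real h * of_real (\<gamma> j)) ^ k / fact k))) \<in> O[at_right 0](\<lambda>h. of_real h ^ Suc n)"
      using exp_taylor_bigo[of "of_real (\<gamma> j)" n] by (rule bigo_cmult)
    then show ?thesis by (simp add: F_def T_def algebra_simps)
  qed
  have F0: "(\<lambda>h. F h j) \<in> O[at_right 0](\<lambda>_. 1)" for j
  proof (rule bigoI_tendsto[of _ _ \<phi>])
    show "((\<lambda>h. F h j / 1) \<longlongrightarrow> \<phi>) (at_right 0)"
      unfolding F_def by (auto intro!: tendsto_eq_intros)
  qed auto
  have z0: "(\<lambda>h. z h i - 0) \<in> O[at_right 0](\<lambda>h. of_real h ^ 0)" if "i \<le> s" for i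
    using stages_bounded[of s z z0 \<alpha> l F, OF eq' F0 that] by simp
  have z1: "(\<lambda>h. z h i - z0) \<in> O[at_right 0](\<lambda>h. of_real h ^ 1)" if "i \<le> s" for i
    using stage_refine[where p = "\<lambda>_ _. 0" and m = 0 and q = "\<lambda>_ _. 0", OF eq' that z0] F0 by simp
  have z2: "(\<lambda>h. z h i - (z0 + of_real h * (g i * \<kappa>))) \<in> O[at_right 0](\<lambda>h. of_real h ^ 2)"
    if "i \<le> s" for i
  proof -
    have "(\<Sum>j\<le>i. of_real (\<alpha> i j) * (l * z0 + T 0 h j)) = g i * \<kappa>" for h
      unfolding row[OF that, symmetric] by (simp add: T_def \<kappa>_def sum_distrib_right)
    then show ?thesis
      using stage_refine[where p = "\<lambda>_ _. z0" and m = 1 and q = "T 0", OF eq' that z1] FT[of _ 0]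
      by (simp add: numeral_2_eq_2)
  qed
  define A where "A i = (\<Sum>j\<le>i. of_real (\<alpha> i j) * g j)" for i
  define p3 where "p3 h i = z0 + of_real h * (g i * \<kappa>) + of_real h ^ 2 * ((l * \<kappa> + \<phi>) * A i)" for h i
  have z3: "(\<lambda>h. z h i - p3 h i) \<in> O[at_right 0](\<lambda>h. of_real h ^ 3)"
    if "i \<le> s" for i
  proof -
    have "z0 + of_real h * (\<Sum>j\<le>i. of_real (\<alpha> i j) * (l * (z0 + of_real h * (g j * \<kappa>)) + T 1 h j)) = p3 h i" for h
    proof -
      have "(\<Sum>j\<le>i. of_real (\<alpha> i j) * (l * (z0 + of_real h * (g j * \<kappa>)) + T 1 h j)) =
          (\<Sum>j\<le>i. of_real (\<alpha> i j) * \<kappa> + of_real h * (l * \<kappa> + \<phi>) * (of_real (\<alpha> i j) * g j))"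
        by (rule sum.cong) (simp_all add: T_def \<kappa>_def g_def algebra_simps)
      also have "\<dots> = g i * \<kappa> + of_real h * (l * \<kappa> + \<phi>) * A i"
        unfolding row[OF that, symmetric] A_def
        by (simp add: sum.distrib sum_distrib_right sum_distrib_left)
      finally show ?thesis by (simp add: p3_def algebra_simps power2_eq_square)
    qed
    then show ?thesis
      using stage_refine[where p = "\<lambda>h j. z0 + of_real h * (g j * \<kappa>)" and m = 2 and q = "T 1",
          OF eq' that z2] FT[of _ 1]
      by (simp add: numeral_2_eq_2 numeral_3_eq_3)
  qed
  define P where "P h = z0 + of_real h * \<kappa> + of_real h ^ 2 * (l * \<kappa> + \<phi>) / 2 +
    of_real h ^ 3 * (l * (l * \<kappa> + \<phi>) + \<phi>) / 6" for h :: real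
  have z4: "(\<lambda>h. z h s - P h) \<in> O[at_right 0](\<lambda>h. of_real h ^ 4)"
  proof -
    have c2: "A s = 1 / 2"
    proof -
      have "A s = of_real (\<Sum>j\<le>s. \<alpha> s j * \<gamma> j)" by (simp add: A_def g_def)
      also have "(\<Sum>j\<le>s. \<alpha> s j * \<gamma> j) = 1 / 2" using oc unfolding third_order_conditions_def by blast
      finally show ?thesis by simp
    qed
    have c3: "(\<Sum>j\<le>s. of_real (\<alpha> s j) * A j) = 1 / 6"
    proof -
      have "(\<Sum>j\<le>s. of_real (\<alpha> s j) * A j) = of_real (\<Sum>j\<le>s. \<alpha> s j * (\<Sum>k\<le>j. \<alpha> j k * \<gamma> k))" by (simp add: A_def g_def)
      also have "(\<Sum>j\<le>s. \<alpha> s j * (\<Sum>k\<le>j. \<alpha> j k * \<gamma> k)) = 1 / 6" using oc unfolding third_order_conditions_def by blast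
      finally show ?thesis by simp
    qed
    have c4: "(\<Sum>j\<le>s. of_real (\<alpha> s j) * g j ^ 2) = 1 / 3"
    proof -
      have "(\<Sum>j\<le>s. of_real (\<alpha> s j) * g j ^ 2) = of_real (\<Sum>j\<le>s. \<alpha> s j * (\<gamma> j)\<^sup>2)" by (simp add: A_def g_def)
      also have "(\<Sum>j\<le>s. \<alpha> s j * (\<gamma> j)\<^sup>2) = 1 / 3" using oc unfolding third_order_conditions_def by blast
      finally show ?thesis by simp
    qed
    have c1: "(\<Sum>j\<le>s. of_real (\<alpha> s j)) = (1 :: complex)"
      using row[of s] oc by (simp add: g_def third_order_conditions_def)
    have "z0 + of_real h * (\<Sum>j\<le>s. of_real (\<alpha> s j) * (l * p3 h j + T 2 h j)) = P h" for h
    proof -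
      have "(\<Sum>j\<le>s. of_real (\<alpha> s j) * (l * p3 h j + T 2 h j)) =
          (\<Sum>j\<le>s. \<kappa> * of_real (\<alpha> s j) + of_real h * (l * \<kappa> + \<phi>) * (of_real (\<alpha> s j) * g j) +
            of_real h ^ 2 * l * (l * \<kappa> + \<phi>) * (of_real (\<alpha> s j) * A j) +
            of_real h ^ 2 * \<phi> / 2 * (of_real (\<alpha> s j) * g j ^ 2))"
        by (rule sum.cong) (simp_all add: T_def p3_def \<kappa>_def g_def numeral_2_eq_2 field_simps)
      also have "\<dots> = \<kappa> * 1 + of_real h * (l * \<kappa> + \<phi>) * (1 / 2) +
          of_real h ^ 2 * l * (l * \<kappa> + \<phi>) * (1 / 6) + of_real h ^ 2 * \<phi> / 2 * (1 / 3)"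
        unfolding sum.distrib sum_distrib_left[symmetric] c1 c2[unfolded A_def] c3 c4 ..
      finally show ?thesis by (simp add: P_def algebra_simps add_divide_distrib power2_eq_square power3_eq_cube)
    qed
    moreover have "(\<lambda>h. F h j - T 2 h j) \<in> O[at_right 0](\<lambda>h. of_real h ^ 3)" for j
      using FT[of j 2] by (simp only: numeral_3_eq_3 numeral_2_eq_2)
    note stage_refine[where i = s and p = p3 and m = 3 and q = "T 2", OF eq' order_refl z3 this]
    ultimately show ?thesis by simp
  qed
  have taylor: "(\<lambda>h. exp (of_real h * c) - (\<Sum>k\<le>3. (of_real h * c) ^ k / fact k))
      \<in> O[at_right 0](\<lambda>h. of_real h ^ 4)" for c :: complex
    using exp_taylor_bigo[of c 3] by simp
  \<comment> \<open>The exact solution is \<open>(z0 - m) exp (h l) + m exp h\<close>, so its remainder is a combination of two exponential remainders.\<close>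
  define m where "m = \<phi> / (1 - l)"
  have "(\<lambda>h. (z0 - m) * (exp (of_real h * l) - (\<Sum>k\<le>3. (of_real h * l) ^ k / fact k)) +
      m * (exp (of_real h * 1) - (\<Sum>k\<le>3. (of_real h * 1) ^ k / fact k)))
      \<in> O[at_right 0](\<lambda>h. of_real h ^ 4)"
    using taylor[of l] taylor[of 1]
    by (intro sum_in_bigo(1) bigo_cmult)
  from sum_in_bigo(2)[OF z4 this] show ?thesis
  proof (rule back_subst[of "\<lambda>f. f \<in> _"], intro ext)
    fix h
    have phi: "\<phi> = m * (1 - l)" using \<open>l \<noteq> 1\<close> by (simp add: m_def)
    have P: "P h = (z0 - m) * (\<Sum>k\<le>3. (of_real h * l) ^ k / fact k) +
        m * (\<Sum>k\<le>3. (of_real h * 1) ^ k / fact k)"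
      unfolding P_def \<kappa>_def phi
      by (simp add: eval_nat_numeral field_simps)
    show "z h s - P h - ((z0 - m) * (exp (of_real h * l) - (\<Sum>k\<le>3. (of_real h * l) ^ k / fact k)) +
      m * (exp (of_real h * 1) - (\<Sum>k\<le>3. (of_real h * 1) ^ k / fact k))) =
      z h s - (exp (of_real h * l) * z0 + \<phi> * (exp (of_real h) - exp (of_real h * l)) / (1 - l))"
      unfolding P times_divide_eq_left[symmetric] m_def[symmetric]
      by (simp add: algebra_simps)
  qed
qed

section \<open>The modal coordinate\<close>

text \<open>An eigenvalue of the companion matrix of the test equation. It is not real for \<open>\<omega> > 0\<close> and
  \<open>0 \<le> \<xi> < 1\<close>, hence the other one is its conjugate.\<close>

definition modal_rate :: "real \<Rightarrow> real \<Rightarrow> complex" where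
  "modal_rate \<xi> \<omega> = Complex (- (\<xi> * \<omega>)) (\<omega> * sqrt (1 - \<xi>\<^sup>2))"

text \<open>The left eigenvector of the companion matrix for the eigenvalue \<open>l\<close> is \<open>(- cnj l, 1)\<close>. Pairing
  the state with it gives one complex number that determines the real state, because \<open>l\<close> is not
  real; \<open>from_modal\<close> is the inverse map.\<close>

definition to_modal :: "complex \<Rightarrow> real vec \<Rightarrow> complex" where
  "to_modal l x = of_real (x $ 1) - cnj l * of_real (x $ 0)"

definition from_modal :: "complex \<Rightarrow> complex \<Rightarrow> real vec" where
  "from_modal l z = vec_of_list [Im z / Im l, Re z + Re l * (Im z / Im l)]"

(* Explicit vectors of length two stay folded, so that the two component rules apply. *)
declare vec_of_list_Cons [simp del]

lemma vec_of_list_2_index [simp]: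
  "vec_of_list [a, b] $ 0 = a" "vec_of_list [a, b] $ 1 = b" "vec_of_list [a, b] $ Suc 0 = b"
  by (simp_all add: vec_of_list_index)

lemma modal_rate:
  assumes "\<xi> \<in> {0..<1}" "\<omega> > 0"
  shows "Im (modal_rate \<xi> \<omega>) > 0" "norm (modal_rate \<xi> \<omega>) = \<omega>"
    "- cnj (modal_rate \<xi> \<omega>) = modal_rate \<xi> \<omega> + 2 * \<xi> * \<omega>"
    "cnj (modal_rate \<xi> \<omega>) * modal_rate \<xi> \<omega> = \<omega>\<^sup>2"
proof -
  have \<xi>: "1 - \<xi>\<^sup>2 > 0" using assms(1) by (simp add: abs_square_less_1)
  then show "Im (modal_rate \<xi> \<omega>) > 0" using assms(2) by (simp add: modal_rate_def)
  have sq: "(\<xi> * \<omega>)\<^sup>2 + (\<omega> * sqrt (1 - \<xi>\<^sup>2))\<^sup>2 = \<omega>\<^sup>2"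
    using \<xi> by (simp add: power_mult_distrib) (simp add: algebra_simps)
  then show n: "norm (modal_rate \<xi> \<omega>) = \<omega>"
    using assms(2) by (simp add: modal_rate_def cmod_def)
  show "- cnj (modal_rate \<xi> \<omega>) = modal_rate \<xi> \<omega> + 2 * \<xi> * \<omega>"
    by (simp add: complex_eq_iff modal_rate_def)
  show "cnj (modal_rate \<xi> \<omega>) * modal_rate \<xi> \<omega> = \<omega>\<^sup>2"
    using complex_norm_square[of "modal_rate \<xi> \<omega>"] n by (simp add: mult.commute)
qed

lemma from_to_modal:
  assumes "Im l \<noteq> 0"
  shows "from_modal l (of_real q - cnj l * of_real p) = vec_of_list [p, q]"
  using assms by (simp add: from_modal_def)

text \<open>In the modal coordinate, the two coupled stage equations become those of the scalar equation
  \<open>z' = l z + f\<close>: by \<open>l + 2 \<xi> \<omega> = - cnj l\<close> and \<open>\<omega>\<^sup>2 = cnj l * l\<close>, the eigenvector combination of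
  velocity and acceleration is \<open>l z + f\<close>.\<close>

lemma stages_modal:
  assumes "\<xi> \<in> {0..<1}" "\<omega> > 0" and st: "substep_stages s \<gamma> \<alpha> \<xi> \<omega> f t h x u v a"
    and "\<alpha> 0 0 = 0" "\<gamma> 0 = 0" and "i \<le> s"
  defines "l \<equiv> modal_rate \<xi> \<omega>"
  defines "z \<equiv> \<lambda>i. complex_of_real (v i) - cnj l * of_real (u i)"
  shows "z i = to_modal l x + of_real h *
    (\<Sum>j\<le>i. of_real (\<alpha> i j) * (l * z j + of_real (f (t + \<gamma> j * h))))"
proof -
  note l = modal_rate(3,4)[OF assms(1,2), folded l_def]
  have S: "u 0 = x $ 0" "v 0 = x $ 1" "a 0 = f t - 2 * \<xi> * \<omega> * v 0 - \<omega>\<^sup>2 * u 0"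
    "\<And>i. i \<in> {1..s} \<Longrightarrow> a i + 2 * \<xi> * \<omega> * v i + \<omega>\<^sup>2 * u i = f (t + \<gamma> i * h)"
    "\<And>i. i \<in> {1..s} \<Longrightarrow> u i = u 0 + h * (\<Sum>j\<le>i. \<alpha> i j * v j)"
    "\<And>i. i \<in> {1..s} \<Longrightarrow> v i = v 0 + h * (\<Sum>j\<le>i. \<alpha> i j * a j)"
    using st unfolding substep_stages_def by blast+
  have z0: "z 0 = to_modal l x" by (simp add: z_def to_modal_def S(1,2))
  have rhs: "l * z j + of_real (f (t + \<gamma> j * h)) = of_real (a j) - cnj l * of_real (v j)"
    if "j \<le> s" for j
  proof -
    have "f (t + \<gamma> j * h) = a j + 2 * \<xi> * \<omega> * v j + \<omega>\<^sup>2 * u j"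
      using S(3,4) that \<open>\<gamma> 0 = 0\<close> by (cases "j = 0") auto
    then have "l * z j + of_real (f (t + \<gamma> j * h)) =
        of_real (a j) + (l + 2 * \<xi> * \<omega>) * v j + (\<omega>\<^sup>2 - cnj l * l) * u j"
      by (simp add: z_def algebra_simps)
    then show ?thesis unfolding l(1)[symmetric] l(2) by simp
  qed
  show ?thesis
  proof (cases "i = 0")
    case True
    then show ?thesis using z0 \<open>\<alpha> 0 0 = 0\<close> by simp
  next
    case False
    then have "i \<in> {1..s}" using \<open>i \<le> s\<close> by simp
    then have "z i = of_real (v 0 + h * (\<Sum>j\<le>i. \<alpha> i j * a j)) -
        cnj l * of_real (u 0 + h * (\<Sum>j\<le>i. \<alpha> i j * v j))"
      unfolding z_def using S(5)[of i] S(6)[of i] by simp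
    also have "\<dots> = z 0 + of_real h *
        (\<Sum>j\<le>i. of_real (\<alpha> i j) * (of_real (a j) - cnj l * of_real (v j)))"
      by (simp add: z_def algebra_simps sum_subtractf sum_distrib_left)
    also have "(\<Sum>j\<le>i. of_real (\<alpha> i j) * (of_real (a j) - cnj l * of_real (v j))) =
        (\<Sum>j\<le>i. of_real (\<alpha> i j) * (l * z j + of_real (f (t + \<gamma> j * h))))"
      using rhs \<open>i \<le> s\<close> by (intro sum.cong) auto
    finally show ?thesis unfolding z0 .
  qed
qed

lemma num_step_modal:
  assumes "\<xi> \<in> {0..<1}" "\<omega> > 0" and "\<alpha> 0 0 = 0" "\<gamma> 0 = 0"
  defines "l \<equiv> modal_rate \<xi> \<omega>"
  shows "\<exists>z. (\<forall>i\<le>s. z i = to_modal l x + of_real h *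
        (\<Sum>j\<le>i. of_real (\<alpha> i j) * (l * z j + of_real (f (t + \<gamma> j * h))))) \<and>
      num_step s \<gamma> \<alpha> \<xi> \<omega> f t h x = from_modal l (z s)"
proof -
  have \<xi>: "\<bar>\<xi>\<bar> < 1" using assms(1) by simp
  obtain u v a where st: "substep_stages s \<gamma> \<alpha> \<xi> \<omega> f t h x u v a"
    using substep_stages_ex[OF \<xi>] by blast
  let ?z = "\<lambda>i. complex_of_real (v i) - cnj l * of_real (u i)"
  have "num_step s \<gamma> \<alpha> \<xi> \<omega> f t h x = from_modal l (?z s)"
    using modal_rate(1)[OF assms(1,2)] num_step_eq[OF \<xi> st] by (simp add: from_to_modal l_def)
  then show ?thesis
    unfolding l_def
    by (intro exI[of _ "\<lambda>i. complex_of_real (v i) - cnj (modal_rate \<xi> \<omega>) * of_real (u i)"] conjI allI impI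
          stages_modal[OF assms(1,2) st assms(3,4)])
qed

section \<open>The amplification matrix and the load vector\<close>

lemma zero_vec_of_list_2: "vec_of_list [0, 0] = (0\<^sub>v 2 :: real vec)"
  by (intro eq_vecI) (auto simp: less_Suc_eq numeral_2_eq_2)

lemma L_num_eq:
  assumes "\<bar>\<xi>\<bar> < 1"
  shows "L_num s \<gamma> \<alpha> \<xi> \<omega> f t h = num_step s \<gamma> \<alpha> \<xi> \<omega> f t h (vec_of_list [0, 0])"
proof -
  have "D_num s \<gamma> \<alpha> \<xi> \<omega> h *\<^sub>v vec_of_list [0, 0] = vec_of_list [0, 0]"
    by (simp add: mult_mat_vec_of_list_2 num_step_affine(1)[OF assms])
  then show ?thesis
    using num_step_affine(2)[OF assms, of s \<gamma> \<alpha> \<omega> f t h]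
      num_step_affine(3)[OF assms, of "vec_of_list [0, 0]" s \<gamma> \<alpha> \<omega> f t h]
    by (simp add: zero_vec_of_list_2)
qed

lemma D_num_mult_vec:
  assumes "\<bar>\<xi>\<bar> < 1" "x \<in> carrier_vec 2"
  shows "D_num s \<gamma> \<alpha> \<xi> \<omega> h *\<^sub>v x = num_step s \<gamma> \<alpha> \<xi> \<omega> (\<lambda>_. 0) t h x"
proof -
  have "substep_stages s \<gamma> \<alpha> \<xi> \<omega> (\<lambda>_. 0) t h (vec_of_list [0, 0]) (\<lambda>_. 0) (\<lambda>_. 0) (\<lambda>_. 0)"
    by (simp add: substep_stages_def)
  then have "L_num s \<gamma> \<alpha> \<xi> \<omega> (\<lambda>_. 0) t h = vec_of_list [0, 0]"
    using num_step_eq[OF assms(1)] by (simp add: L_num_eq[OF assms(1)])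
  moreover have "D_num s \<gamma> \<alpha> \<xi> \<omega> h *\<^sub>v x \<in> carrier_vec 2"
    using num_step_affine(1)[OF assms(1)] assms(2) by (rule mult_mat_vec_carrier)
  then have "D_num s \<gamma> \<alpha> \<xi> \<omega> h *\<^sub>v x + vec_of_list [0, 0] = D_num s \<gamma> \<alpha> \<xi> \<omega> h *\<^sub>v x"
    by (simp add: zero_vec_of_list_2)
  ultimately show ?thesis
    using num_step_affine(3)[OF assms, of s \<gamma> \<alpha> \<omega> "\<lambda>_. 0" t h] by simp
qed

text \<open>Multiplication by the complex number \<open>w\<close> in the modal coordinate, written as a real matrix in
  the coordinates (displacement, velocity).\<close>

definition modal_mat :: "complex \<Rightarrow> complex \<Rightarrow> real mat" where
  "modal_mat l w = mat_of_rows_list 2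
     [[Re w - Re l * Im w / Im l, Im w / Im l],
      [- (norm l)\<^sup>2 * Im w / Im l, Re w + Re l * Im w / Im l]]"

lemma modal_mat_carrier: "modal_mat l w \<in> carrier_mat 2 2"
  by (simp add: modal_mat_def mat_of_rows_list_def numeral_2_eq_2)

lemma modal_mat_mult:
  assumes "Im l \<noteq> 0" "x \<in> carrier_vec 2"
  shows "modal_mat l w *\<^sub>v x = from_modal l (w * to_modal l x)"
proof -
  obtain p q where x: "x = vec_of_list [p, q]" using carrier_vec_2_eq[OF assms(2)] by blast
  have e: "modal_mat l w $$ (0, 0) = Re w - Re l * Im w / Im l" "modal_mat l w $$ (0, 1) = Im w / Im l"
    "modal_mat l w $$ (1, 0) = - (norm l)\<^sup>2 * Im w / Im l"
    "modal_mat l w $$ (1, 1) = Re w + Re l * Im w / Im l"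
    by (simp_all add: modal_mat_def mat_of_rows_list_def)
  show ?thesis
    unfolding x mult_mat_vec_of_list_2[OF modal_mat_carrier] e
    using assms(1)
    by (simp add: from_modal_def to_modal_def cmod_power2) (simp add: field_simps power2_eq_square)
qed

lemma D_num_eq_modal_mat:
  assumes "\<xi> \<in> {0..<1}" "\<omega> > 0" and "\<alpha> 0 0 = 0" "\<gamma> 0 = 0"
    and amp: "\<And>z. (\<And>i. i \<le> s \<Longrightarrow>
        z i = z 0 + of_real h * (\<Sum>j\<le>i. of_real (\<alpha> i j) * (modal_rate \<xi> \<omega> * z j))) \<Longrightarrow> z s = w * z 0"
  shows "D_num s \<gamma> \<alpha> \<xi> \<omega> h = modal_mat (modal_rate \<xi> \<omega>) w"
proof (rule mat_2_eqI)
  have \<xi>: "\<bar>\<xi>\<bar> < 1" using assms(1) by simp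
  then show "D_num s \<gamma> \<alpha> \<xi> \<omega> h \<in> carrier_mat 2 2" by (rule num_step_affine)
  show "modal_mat (modal_rate \<xi> \<omega>) w \<in> carrier_mat 2 2" by (rule modal_mat_carrier)
  fix x :: "real vec" assume x: "x \<in> carrier_vec 2"
  obtain z where z: "\<forall>i\<le>s. z i = to_modal (modal_rate \<xi> \<omega>) x + of_real h *
      (\<Sum>j\<le>i. of_real (\<alpha> i j) * (modal_rate \<xi> \<omega> * z j + of_real 0))"
    and n: "num_step s \<gamma> \<alpha> \<xi> \<omega> (\<lambda>_. 0) 0 h x = from_modal (modal_rate \<xi> \<omega>) (z s)"
    using num_step_modal[where \<alpha> = \<alpha> and \<gamma> = \<gamma> and f = "\<lambda>_. 0", OF assms(1-4)] by blast
  have z0: "z 0 = to_modal (modal_rate \<xi> \<omega>) x" using z[rule_format, of 0] assms(3) by simp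
  have "z s = w * z 0"
  proof (rule amp)
    fix i assume "i \<le> s"
    show "z i = z 0 + of_real h * (\<Sum>j\<le>i. of_real (\<alpha> i j) * (modal_rate \<xi> \<omega> * z j))"
      using z[rule_format, OF \<open>i \<le> s\<close>] unfolding z0 of_real_0 add_0_right .
  qed
  then show "D_num s \<gamma> \<alpha> \<xi> \<omega> h *\<^sub>v x = modal_mat (modal_rate \<xi> \<omega>) w *\<^sub>v x"
    unfolding D_num_mult_vec[OF \<xi> x, of _ _ _ _ _ 0] n
    using modal_rate(1)[OF assms(1,2)] modal_mat_mult[OF _ x] z0 by simp
qed

section \<open>The exact solution and accuracy\<close>

text \<open>Variation of constants for \<open>z' = l z + \<phi> exp t\<close>. The denominator does not vanish, as \<open>l\<close> is not
  real.\<close>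

lemma exact_solution_modal:
  fixes \<xi> \<omega> \<phi> :: real and z0 :: complex
  assumes "\<xi> \<in> {0..<1}" "\<omega> > 0"
  defines "l \<equiv> modal_rate \<xi> \<omega>"
  defines "z \<equiv> \<lambda>t. exp (of_real t * l) * z0 + of_real \<phi> * (exp (of_real t) - exp (of_real t * l)) / (1 - l)"
  shows "exact_solution \<xi> \<omega> (\<lambda>t. \<phi> * exp t)
    (\<lambda>t. from_modal l (z t) $ 0) (\<lambda>t. from_modal l (z t) $ 1)"
proof -
  note l = modal_rate[OF assms(1,2), folded l_def]
  have Re: "Re l = - (\<xi> * \<omega>)" by (simp add: l_def modal_rate_def)
  have \<omega>: "\<omega>\<^sup>2 = (Re l)\<^sup>2 + (Im l)\<^sup>2" using l(2) cmod_power2[of l] by simp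
  have l1: "1 - l \<noteq> 0" using l(1) by auto
  have z': "(z has_vector_derivative (l * z t + of_real (\<phi> * exp t))) (at t)" for t
  proof -
    have e: "((\<lambda>t. exp (of_real t * c)) has_vector_derivative (c * exp (of_real t * c))) (at t)" for c :: complex
    proof -
      have "((\<lambda>t. of_real t * c) has_derivative (\<lambda>x. of_real x * c)) (at t)"
        by (auto intro!: derivative_eq_intros)
      from has_derivative_compose[OF this DERIV_exp[unfolded has_field_derivative_def]]
      show ?thesis by (simp add: has_vector_derivative_def scaleR_conv_of_real mult_ac)
    qed
    have "(z has_vector_derivative (l * exp (of_real t * l) * z0 + of_real \<phi> * (1 * exp (of_real t * 1) - l * exp (of_real t * l)) / (1 - l))) (at t)"
      unfolding z_def using e[of l] e[of 1]
      by (auto intro!: derivative_eq_intros)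
    also have "l * exp (of_real t * l) * z0 + of_real \<phi> * (1 * exp (of_real t * 1) - l * exp (of_real t * l)) / (1 - l)
        = l * z t + of_real (\<phi> * exp t)"
      using l1 by (simp add: z_def exp_of_real field_simps)
    finally show ?thesis .
  qed
  then have ReIm: "((\<lambda>t. Re (z t)) has_real_derivative Re (l * z t + of_real (\<phi> * exp t))) (at t)"
    "((\<lambda>t. Im (z t)) has_real_derivative Im (l * z t + of_real (\<phi> * exp t))) (at t)" for t
    by (auto simp: has_vector_derivative_complex_iff)
  show ?thesis
    unfolding exact_solution_def from_modal_def vec_of_list_2_index
  proof (intro allI conjI)
    fix t
    have "Im (l * z t + of_real (\<phi> * exp t)) / Im l = Re (z t) + Re l * (Im (z t) / Im l)"
      using l(1) by (simp add: field_simps)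
    then show "((\<lambda>t. Im (z t) / Im l) has_real_derivative Re (z t) + Re l * (Im (z t) / Im l)) (at t)"
      using DERIV_cdivide[OF ReIm(2)[of t], of "Im l"] by simp
    have c: "2 * \<xi> * \<omega> = - 2 * Re l" by (simp add: Re)
    have "Re (l * z t + of_real (\<phi> * exp t)) + Re l * (Im (l * z t + of_real (\<phi> * exp t)) / Im l) =
      \<phi> * exp t - 2 * \<xi> * \<omega> * (Re (z t) + Re l * (Im (z t) / Im l)) - \<omega>\<^sup>2 * (Im (z t) / Im l)"
      unfolding c \<omega> using l(1) by (simp add: field_simps power2_eq_square)
    then show "((\<lambda>t. Re (z t) + Re l * (Im (z t) / Im l)) has_real_derivative
        \<phi> * exp t - 2 * \<xi> * \<omega> * (Re (z t) + Re l * (Im (z t) / Im l)) - \<omega>\<^sup>2 * (Im (z t) / Im l)) (at t)"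
      using DERIV_add[OF ReIm(1)[of t] DERIV_cmult[OF DERIV_cdivide[OF ReIm(2)[of t], of "Im l"], of "Re l"]]
      by (simp only:)
  qed
qed

lemma from_modal_eq_vec: "vec_of_list [from_modal l z $ 0, from_modal l z $ Suc 0] = from_modal l z"
  by (simp add: from_modal_def)

lemma from_modal_bigo:
  assumes "i < 2"
    and O: "(\<lambda>h. z h - w h) \<in> O[at_right 0](\<lambda>h. of_real h ^ p)"
  shows "(\<lambda>h. from_modal l (z h) $ i - from_modal l (w h) $ i) \<in> O[at_right 0](\<lambda>h. h ^ p)"
proof -
  obtain c where c: "eventually (\<lambda>h. norm (z h - w h) \<le> c * norm (of_real h ^ p :: complex)) (at_right 0)"
    using landau_o.bigE[OF O] by blast
  have Re: "(\<lambda>h. Re (z h - w h)) \<in> O[at_right 0](\<lambda>h. h ^ p)"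
  proof (rule bigoI[of _ c])
    show "eventually (\<lambda>h. norm (Re (z h - w h)) \<le> c * norm (h ^ p)) (at_right 0)"
      using c
    proof eventually_elim
      case (elim h)
      have "\<bar>Re (z h - w h)\<bar> \<le> norm (z h - w h)" by (rule abs_Re_le_cmod)
      with elim show ?case by (simp add: norm_power power_abs)
    qed
  qed
  have Im: "(\<lambda>h. Im (z h - w h)) \<in> O[at_right 0](\<lambda>h. h ^ p)"
  proof (rule bigoI[of _ c])
    show "eventually (\<lambda>h. norm (Im (z h - w h)) \<le> c * norm (h ^ p)) (at_right 0)"
      using c
    proof eventually_elim
      case (elim h)
      have "\<bar>Im (z h - w h)\<bar> \<le> norm (z h - w h)" by (rule abs_Im_le_cmod)
      with elim show ?case by (simp add: norm_power power_abs)
    qed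
  qed
  have Im': "(\<lambda>h. k * Im (z h - w h)) \<in> O[at_right 0](\<lambda>h. h ^ p)" for k
    using Im by (cases "k = 0") auto
  from \<open>i < 2\<close> consider "i = 0" | "i = 1" by linarith
  then show ?thesis
  proof cases
    case 1
    have "from_modal l (z h) $ i - from_modal l (w h) $ i = 1 / Im l * Im (z h - w h)" for h
      by (simp add: 1 from_modal_def diff_divide_distrib)
    then show ?thesis using Im' by presburger
  next
    case 2
    have "from_modal l (z h) $ i - from_modal l (w h) $ i =
        Re (z h - w h) + Re l / Im l * Im (z h - w h)" for h
      by (simp add: 2 from_modal_def diff_divide_distrib algebra_simps)
    then show ?thesis using sum_in_bigo(1)[OF Re Im'] by presburger
  qed
qed

lemma num_step_third_order:
  fixes \<phi> :: real
  assumes oc: "third_order_conditions s \<gamma> \<alpha>" and \<xi>: "\<xi> \<in> {0..<1}" and \<omega>: "\<omega> > 0" and "i < 2"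
  defines "l \<equiv> modal_rate \<xi> \<omega>"
  shows "(\<lambda>h. num_step s \<gamma> \<alpha> \<xi> \<omega> (\<lambda>t. \<phi> * exp t) 0 h x $ i -
      from_modal l (exp (of_real h * l) * to_modal l x +
        of_real \<phi> * (exp (of_real h) - exp (of_real h * l)) / (1 - l)) $ i)
    \<in> O[at_right 0](\<lambda>h. h ^ 4)"
proof -
  have \<alpha>0: "\<alpha> 0 0 = 0" using oc by (simp add: third_order_conditions_def)
  have \<gamma>0: "\<gamma> 0 = 0" using oc \<alpha>0 by (auto simp: third_order_conditions_def)
  have "\<forall>h. \<exists>z. (\<forall>i\<le>s. z i = to_modal l x + of_real h *
        (\<Sum>j\<le>i. of_real (\<alpha> i j) * (l * z j + of_real \<phi> * exp (of_real (\<gamma> j * h))))) \<and>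
      num_step s \<gamma> \<alpha> \<xi> \<omega> (\<lambda>t. \<phi> * exp t) 0 h x = from_modal l (z s)"
  proof
    fix h
    have f: "complex_of_real (\<phi> * exp (0 + \<gamma> j * h)) = of_real \<phi> * exp (of_real (\<gamma> j * h))" for j
      by (simp only: add_0_left of_real_mult[of \<phi>] exp_of_real)
    show "\<exists>z. (\<forall>i\<le>s. z i = to_modal l x + of_real h *
        (\<Sum>j\<le>i. of_real (\<alpha> i j) * (l * z j + of_real \<phi> * exp (of_real (\<gamma> j * h))))) \<and>
      num_step s \<gamma> \<alpha> \<xi> \<omega> (\<lambda>t. \<phi> * exp t) 0 h x = from_modal l (z s)"
      unfolding l_def
      by (rule num_step_modal[where \<alpha> = \<alpha> and \<gamma> = \<gamma> and f = "\<lambda>t. \<phi> * exp t" and t = 0 and h = h,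
            OF \<xi> \<omega> \<alpha>0 \<gamma>0, unfolded f])
  qed
  from choice[OF this] obtain z where zn: "\<forall>h. (\<forall>i\<le>s. z h i = to_modal l x + of_real h *
        (\<Sum>j\<le>i. of_real (\<alpha> i j) * (l * z h j + of_real \<phi> * exp (of_real (\<gamma> j * h))))) \<and>
      num_step s \<gamma> \<alpha> \<xi> \<omega> (\<lambda>t. \<phi> * exp t) 0 h x = from_modal l (z h s)" ..
  have z: "z h i = to_modal l x + of_real h *
      (\<Sum>j\<le>i. of_real (\<alpha> i j) * (l * z h j + of_real \<phi> * exp (of_real (\<gamma> j * h))))"
    if "i \<le> s" for h i
    using conjunct1[OF spec[OF zn]] that by blast
  have n: "num_step s \<gamma> \<alpha> \<xi> \<omega> (\<lambda>t. \<phi> * exp t) 0 h x = from_modal l (z h s)" for h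
    by (rule conjunct2[OF spec[OF zn]])
  have "l \<noteq> 1" using modal_rate(1)[OF \<xi> \<omega>] by (auto simp: l_def)
  show ?thesis
    unfolding n by (rule from_modal_bigo[OF \<open>i < 2\<close> stages_third_order[OF z oc \<open>l \<noteq> 1\<close>]])
qed

lemma exact_modal:
  assumes \<xi>: "\<xi> \<in> {0..<1}" and \<omega>: "\<omega> > 0" and "h \<ge> 0"
  defines "l \<equiv> modal_rate \<xi> \<omega>"
  shows "x \<in> carrier_vec 2 \<Longrightarrow> D_exa \<xi> \<omega> h *\<^sub>v x = from_modal l (exp (of_real h * l) * to_modal l x)"
    and "L_exa \<xi> \<omega> h = from_modal l ((exp (of_real h) - exp (of_real h * l)) / (1 - l))"
proof -
  have l: "Im l \<noteq> 0" using modal_rate(1)[OF \<xi> \<omega>] by (simp add: l_def)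
  note ex = exact_solution_modal[OF \<xi> \<omega>, folded l_def]
  show "D_exa \<xi> \<omega> h *\<^sub>v x = from_modal l (exp (of_real h * l) * to_modal l x)"
    if x: "x \<in> carrier_vec 2"
  proof -
    have "from_modal l (to_modal l x) = x"
      unfolding to_modal_def from_to_modal[OF l] using carrier_vec_2_eq[OF x] by simp
    moreover have "vec_of_list [x $ 0, x $ Suc 0] = x" using carrier_vec_2_eq[OF x] by simp
    ultimately show ?thesis
      using D_exa(2)[OF \<xi> \<omega> \<open>h \<ge> 0\<close>, OF ex[of 0 "to_modal l x", unfolded mult_zero_left]]
      by (simp add: from_modal_eq_vec)
  qed
  have z: "from_modal l 0 $ 0 = 0" "from_modal l 0 $ 1 = 0" by (simp_all add: from_modal_def)
  show "L_exa \<xi> \<omega> h = from_modal l ((exp (of_real h) - exp (of_real h * l)) / (1 - l))"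
    using L_exa[OF \<xi> \<omega> \<open>h \<ge> 0\<close>, OF ex[of 1 0, unfolded mult_1_left]] z
    by (simp add: from_modal_eq_vec)
qed

text \<open>The columns of the two propagators are the images of the unit vectors without load, and the
  load vectors are the images of the zero state. So all entries are covered by the modal expansion
  with \<open>\<phi> = 0\<close> or \<open>\<phi> = 1\<close>.\<close>

theorem third_order_accurate:
  assumes oc: "third_order_conditions s \<gamma> \<alpha>"
  shows "accurate_of_order 3 s \<gamma> \<alpha>"
  unfolding accurate_of_order_def
proof (intro allI impI ballI conjI)
  fix \<omega> \<xi> :: real and i :: nat
  assume \<omega>: "\<omega> > 0" and \<xi>: "\<xi> \<in> {0..<1}" and i: "i < 2"
  have \<xi>': "\<bar>\<xi>\<bar> < 1" using \<xi> by simp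
  have pos: "eventually (\<lambda>h::real. h > 0) (at_right 0)" by (rule eventually_at_right_less)
  note ts = num_step_third_order[OF oc \<xi> \<omega> i]
  let ?l = "modal_rate \<xi> \<omega>"
  show "(\<lambda>h. L_num s \<gamma> \<alpha> \<xi> \<omega> exp 0 h $ i - L_exa \<xi> \<omega> h $ i) \<in> O[at_right 0](\<lambda>h. h ^ (3 + 1))"
  proof (rule iffD1[OF landau_o.big.in_cong])
    show "(\<lambda>h. num_step s \<gamma> \<alpha> \<xi> \<omega> (\<lambda>t. 1 * exp t) 0 h (vec_of_list [0, 0]) $ i -
      from_modal ?l (exp (of_real h * ?l) * to_modal ?l (vec_of_list [0, 0]) +
        of_real 1 * (exp (of_real h) - exp (of_real h * ?l)) / (1 - ?l)) $ i)
      \<in> O[at_right 0](\<lambda>h. h ^ (3 + 1))"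
      using ts[of 1 "vec_of_list [0, 0]"] by simp
    show "eventually (\<lambda>h. num_step s \<gamma> \<alpha> \<xi> \<omega> (\<lambda>t. 1 * exp t) 0 h (vec_of_list [0, 0]) $ i -
      from_modal ?l (exp (of_real h * ?l) * to_modal ?l (vec_of_list [0, 0]) +
        of_real 1 * (exp (of_real h) - exp (of_real h * ?l)) / (1 - ?l)) $ i =
      L_num s \<gamma> \<alpha> \<xi> \<omega> exp 0 h $ i - L_exa \<xi> \<omega> h $ i) (at_right 0)"
      using pos by eventually_elim
        (simp add: L_num_eq[OF \<xi>'] exact_modal(2)[OF \<xi> \<omega>] to_modal_def)
  qed
  fix j :: nat assume j: "j < 2"
  define e where "e = vec_of_list [if j = 0 then 1 else 0, if j = 0 then 0 else 1 :: real]"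
  have e: "e \<in> carrier_vec 2" by (simp add: e_def)
  have entry: "(D *\<^sub>v e) $ i = D $$ (i, j)" if "D \<in> carrier_mat 2 2" for D :: "real mat"
    using i j unfolding e_def mult_mat_vec_of_list_2[OF that] by (auto simp: less_2_cases_iff)
  show "(\<lambda>h. D_num s \<gamma> \<alpha> \<xi> \<omega> h $$ (i, j) - D_exa \<xi> \<omega> h $$ (i, j)) \<in> O[at_right 0](\<lambda>h. h ^ (3 + 1))"
  proof (rule iffD1[OF landau_o.big.in_cong])
    show "(\<lambda>h. num_step s \<gamma> \<alpha> \<xi> \<omega> (\<lambda>t. 0 * exp t) 0 h e $ i -
      from_modal ?l (exp (of_real h * ?l) * to_modal ?l e +
        of_real 0 * (exp (of_real h) - exp (of_real h * ?l)) / (1 - ?l)) $ i)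
      \<in> O[at_right 0](\<lambda>h. h ^ (3 + 1))"
      using ts[of 0 e] by simp
    show "eventually (\<lambda>h. num_step s \<gamma> \<alpha> \<xi> \<omega> (\<lambda>t. 0 * exp t) 0 h e $ i -
      from_modal ?l (exp (of_real h * ?l) * to_modal ?l e +
        of_real 0 * (exp (of_real h) - exp (of_real h * ?l)) / (1 - ?l)) $ i =
      D_num s \<gamma> \<alpha> \<xi> \<omega> h $$ (i, j) - D_exa \<xi> \<omega> h $$ (i, j)) (at_right 0)"
      using pos
    proof eventually_elim
      case (elim h)
      then have "h \<ge> 0" by simp
      show ?case
        unfolding entry[OF num_step_affine(1)[OF \<xi>'], symmetric]
          entry[OF D_exa(1)[OF \<xi> \<omega> \<open>h \<ge> 0\<close>], symmetric]
          D_num_mult_vec[OF \<xi>' e, of _ _ _ _ _ 0] exact_modal(1)[OF \<xi> \<omega> \<open>h \<ge> 0\<close> e]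
        by simp
    qed
  qed
qed

section \<open>Characteristic polynomial and spectral radius\<close>

lemma char_poly_2:
  fixes A :: "'a :: comm_ring_1 mat"
  assumes A: "A \<in> carrier_mat 2 2"
  shows "char_poly A = [:A $$ (0, 0) * A $$ (1, 1) - A $$ (0, 1) * A $$ (1, 0), - (A $$ (0, 0) + A $$ (1, 1)), 1:]"
proof -
  have det: "det M = M $$ (0, 0) * M $$ (1, 1) - M $$ (0, 1) * M $$ (1, 0)"
    if M: "M \<in> carrier_mat 2 2" for M :: "'a poly mat"
  proof -
    have "det M = (\<Sum>i<2. M $$ (i, 0) * cofactor M i 0)"
      by (rule laplace_expansion_column[OF M]) simp
    moreover have "cofactor M 0 0 = M $$ (1, 1)"
      unfolding cofactor_def using M by (subst det_single) (auto simp: mat_delete_def)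
    moreover have "cofactor M 1 0 = - M $$ (0, 1)"
      unfolding cofactor_def using M by (subst det_single) (auto simp: mat_delete_def)
    ultimately show ?thesis by (simp add: numeral_2_eq_2)
  qed
  show ?thesis
    unfolding char_poly_def det[OF char_poly_matrix_closed[OF A]]
    using A by (simp add: char_poly_matrix_def algebra_simps)
qed

lemma char_poly_modal_mat:
  assumes "Im l \<noteq> 0"
  shows "char_poly (modal_mat l w) = [:(norm w)\<^sup>2, - 2 * Re w, 1:]"
proof -
  have e: "modal_mat l w $$ (0, 0) = Re w - Re l * Im w / Im l" "modal_mat l w $$ (0, 1) = Im w / Im l"
    "modal_mat l w $$ (1, 0) = - (norm l)\<^sup>2 * Im w / Im l"
    "modal_mat l w $$ (1, 1) = Re w + Re l * Im w / Im l"
    by (simp_all add: modal_mat_def mat_of_rows_list_def)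
  show ?thesis
    unfolding char_poly_2[OF modal_mat_carrier] e using assms
    by (simp only: cmod_power2) (simp add: field_simps power2_eq_square)
qed

text \<open>The matrix is similar to the rotation-dilation by \<open>w\<close>, so its eigenvalues are \<open>w\<close> and \<open>cnj w\<close>.\<close>

lemma spectral_radius_modal_mat:
  assumes "Im l \<noteq> 0"
  shows "spectral_radius (map_mat complex_of_real (modal_mat l w)) = norm w"
proof -
  let ?A = "map_mat complex_of_real (modal_mat l w)"
  have A: "?A \<in> carrier_mat 2 2" using modal_mat_carrier by simp
  have "char_poly ?A = map_poly of_real (char_poly (modal_mat l w))"
    by (rule of_real_hom.char_poly_hom[OF modal_mat_carrier])
  then have cp: "char_poly ?A = [:of_real ((norm w)\<^sup>2), - 2 * of_real (Re w), 1:]"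
    unfolding char_poly_modal_mat[OF assms] by simp
  have "poly (char_poly ?A) k = (k - w) * (k - cnj w)" for k
  proof -
    have "of_real ((norm w)\<^sup>2) = w * cnj w" by (rule complex_norm_square)
    moreover have "2 * of_real (Re w) = w + cnj w" by (simp add: complex_add_cnj)
    ultimately show ?thesis unfolding cp by (simp add: algebra_simps)
  qed
  then have "spectrum ?A = {w, cnj w}"
    unfolding spectrum_root_char_poly[OF A] by auto
  then show ?thesis unfolding spectral_radius_def by simp
qed

section \<open>The order conditions and the stability function of SUCI3\<close>

text \<open>Keeping \<open>\<alpha> 3 2\<close> as an unknown \<open>b\<close> with a single polynomial relation avoids denominators in
  \<open>\<gamma>2\<close> and shows why \<open>\<gamma>2\<close> cancels from all quantities below.\<close>

lemma suci3_coeffs_table: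
  assumes "\<gamma>1 > 0" "\<gamma>2 \<noteq> 0" "\<gamma>2 \<noteq> \<gamma>1"
  obtains b where
    "b * (\<gamma>2 * (\<gamma>2 - \<gamma>1)) = (3 * \<gamma>1\<^sup>2 - 6 * \<gamma>1 + 2) / 6"
    "suci3_coeffs \<gamma>1 \<gamma>2 0 0 = 0"
    "suci3_coeffs \<gamma>1 \<gamma>2 1 0 = \<gamma>1 / 2" "suci3_coeffs \<gamma>1 \<gamma>2 1 1 = \<gamma>1 / 2"
    "suci3_coeffs \<gamma>1 \<gamma>2 2 0 = (- \<gamma>1\<^sup>2 + 3 * \<gamma>1 * \<gamma>2 - \<gamma>2\<^sup>2) / (2 * \<gamma>1)"
    "suci3_coeffs \<gamma>1 \<gamma>2 2 1 = \<gamma>2 * (\<gamma>2 - \<gamma>1) / (2 * \<gamma>1)" "suci3_coeffs \<gamma>1 \<gamma>2 2 2 = \<gamma>1 / 2"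
    "suci3_coeffs \<gamma>1 \<gamma>2 3 0 = (- \<gamma>1\<^sup>2 + (3 - 2 * b) * \<gamma>1 + 2 * b * \<gamma>2 - 1) / (2 * \<gamma>1)"
    "suci3_coeffs \<gamma>1 \<gamma>2 3 1 = (- 2 * b * \<gamma>2 - \<gamma>1 + 1) / (2 * \<gamma>1)"
    "suci3_coeffs \<gamma>1 \<gamma>2 3 2 = b" "suci3_coeffs \<gamma>1 \<gamma>2 3 3 = \<gamma>1 / 2"
proof -
  define b where "b = (3 * \<gamma>1\<^sup>2 - 6 * \<gamma>1 + 2) / (6 * \<gamma>2 * (\<gamma>2 - \<gamma>1))"
  have table: "suci3_coeffs \<gamma>1 \<gamma>2 i j =
      [[0, 0, 0, 0],
       [\<gamma>1 / 2, \<gamma>1 / 2, 0, 0],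
       [(- \<gamma>1\<^sup>2 + 3 * \<gamma>1 * \<gamma>2 - \<gamma>2\<^sup>2) / (2 * \<gamma>1), \<gamma>2 * (\<gamma>2 - \<gamma>1) / (2 * \<gamma>1), \<gamma>1 / 2, 0],
       [(- \<gamma>1\<^sup>2 + (3 - 2 * b) * \<gamma>1 + 2 * b * \<gamma>2 - 1) / (2 * \<gamma>1),
        (- 2 * b * \<gamma>2 - \<gamma>1 + 1) / (2 * \<gamma>1), b, \<gamma>1 / 2]] ! i ! j" for i j
    unfolding suci3_coeffs_def Let_def b_def by (rule refl)
  have "x / (6 * d) * d = x / 6" if "d \<noteq> 0" for x d :: real using that by simp
  from this[of "\<gamma>2 * (\<gamma>2 - \<gamma>1)"] assms
  have "b * (\<gamma>2 * (\<gamma>2 - \<gamma>1)) = (3 * \<gamma>1\<^sup>2 - 6 * \<gamma>1 + 2) / 6"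
    unfolding b_def by (simp only: mult.assoc) simp
  then show thesis by (rule that) (simp_all add: table)
qed

lemma suci3_nodes_table:
  "suci3_nodes \<gamma>1 \<gamma>2 0 = 0" "suci3_nodes \<gamma>1 \<gamma>2 1 = \<gamma>1" "suci3_nodes \<gamma>1 \<gamma>2 2 = \<gamma>2"
  "suci3_nodes \<gamma>1 \<gamma>2 3 = 1"
  by (simp_all add: suci3_nodes_def eval_nat_numeral)

lemma sum_atMost_1: "(\<Sum>j\<le>1. f j) = f 0 + f (1::nat)"
  and sum_atMost_2: "(\<Sum>j\<le>2. f j) = f 0 + f 1 + f (2::nat)"
  and sum_atMost_3: "(\<Sum>j\<le>3. f j) = f 0 + f 1 + f 2 + f (3::nat)"
  for f :: "nat \<Rightarrow> 'a :: comm_monoid_add"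
  by (simp_all add: eval_nat_numeral)

lemma suci3_third_order_conditions:
  assumes "\<gamma>1 > 0" "\<gamma>2 \<noteq> 0" "\<gamma>2 \<noteq> \<gamma>1"
  shows "third_order_conditions 3 (suci3_nodes \<gamma>1 \<gamma>2) (suci3_coeffs \<gamma>1 \<gamma>2)"
proof -
  obtain b where b: "b * (\<gamma>2 * (\<gamma>2 - \<gamma>1)) = (3 * \<gamma>1\<^sup>2 - 6 * \<gamma>1 + 2) / 6"
    and c: "suci3_coeffs \<gamma>1 \<gamma>2 0 0 = 0"
    "suci3_coeffs \<gamma>1 \<gamma>2 1 0 = \<gamma>1 / 2" "suci3_coeffs \<gamma>1 \<gamma>2 1 1 = \<gamma>1 / 2"
    "suci3_coeffs \<gamma>1 \<gamma>2 2 0 = (- \<gamma>1\<^sup>2 + 3 * \<gamma>1 * \<gamma>2 - \<gamma>2\<^sup>2) / (2 * \<gamma>1)"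
    "suci3_coeffs \<gamma>1 \<gamma>2 2 1 = \<gamma>2 * (\<gamma>2 - \<gamma>1) / (2 * \<gamma>1)" "suci3_coeffs \<gamma>1 \<gamma>2 2 2 = \<gamma>1 / 2"
    "suci3_coeffs \<gamma>1 \<gamma>2 3 0 = (- \<gamma>1\<^sup>2 + (3 - 2 * b) * \<gamma>1 + 2 * b * \<gamma>2 - 1) / (2 * \<gamma>1)"
    "suci3_coeffs \<gamma>1 \<gamma>2 3 1 = (- 2 * b * \<gamma>2 - \<gamma>1 + 1) / (2 * \<gamma>1)"
    "suci3_coeffs \<gamma>1 \<gamma>2 3 2 = b" "suci3_coeffs \<gamma>1 \<gamma>2 3 3 = \<gamma>1 / 2"
    by (rule suci3_coeffs_table[OF assms])
  note e = c suci3_nodes_table sum_atMost_1 sum_atMost_2 sum_atMost_3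
  have rows: "\<forall>i\<le>3. (\<Sum>j\<le>i. suci3_coeffs \<gamma>1 \<gamma>2 i j) = suci3_nodes \<gamma>1 \<gamma>2 i"
  proof (intro allI impI)
    fix i :: nat assume "i \<le> 3"
    then consider "i = 0" | "i = 1" | "i = 2" | "i = 3" by linarith
    then show "(\<Sum>j\<le>i. suci3_coeffs \<gamma>1 \<gamma>2 i j) = suci3_nodes \<gamma>1 \<gamma>2 i"
    proof cases
      case 1 show ?thesis unfolding 1 atMost_0 by (simp add: e)
    next
      case 2 show ?thesis unfolding 2 e by simp
    next
      case 3 show ?thesis unfolding 3 e using assms(1) by (simp add: field_simps power2_eq_square)
    next
      case 4 show ?thesis unfolding 4 e using assms(1) by (simp add: field_simps power2_eq_square)
    qed
  qed
  have s2: "(\<Sum>j\<le>3. suci3_coeffs \<gamma>1 \<gamma>2 3 j * suci3_nodes \<gamma>1 \<gamma>2 j) = 1 / 2"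
    unfolding e using assms(1) by (simp add: field_simps)
  have "(\<Sum>j\<le>3. suci3_coeffs \<gamma>1 \<gamma>2 3 j * (suci3_nodes \<gamma>1 \<gamma>2 j)\<^sup>2) =
      - \<gamma>1\<^sup>2 / 2 + \<gamma>1 + b * (\<gamma>2 * (\<gamma>2 - \<gamma>1))"
    unfolding e using assms(1) by (simp add: field_simps power2_eq_square)
  also have "\<dots> = 1 / 3" unfolding b by (simp add: field_simps)
  finally have s3: "(\<Sum>j\<le>3. suci3_coeffs \<gamma>1 \<gamma>2 3 j * (suci3_nodes \<gamma>1 \<gamma>2 j)\<^sup>2) = 1 / 3" .
  have q1: "(\<Sum>k\<le>1. suci3_coeffs \<gamma>1 \<gamma>2 1 k * suci3_nodes \<gamma>1 \<gamma>2 k) = \<gamma>1\<^sup>2 / 2"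
    unfolding e by (simp add: power2_eq_square)
  have q2: "(\<Sum>k\<le>2. suci3_coeffs \<gamma>1 \<gamma>2 2 k * suci3_nodes \<gamma>1 \<gamma>2 k) = \<gamma>2\<^sup>2 / 2"
    unfolding e using assms(1) by (simp add: field_simps power2_eq_square)
  have "(\<Sum>j\<le>3. suci3_coeffs \<gamma>1 \<gamma>2 3 j * (\<Sum>k\<le>j. suci3_coeffs \<gamma>1 \<gamma>2 j k * suci3_nodes \<gamma>1 \<gamma>2 k)) =
      - \<gamma>1\<^sup>2 / 4 + \<gamma>1 / 2 + b * (\<gamma>2 * (\<gamma>2 - \<gamma>1)) / 2"
    unfolding sum_atMost_3[of "\<lambda>j. suci3_coeffs \<gamma>1 \<gamma>2 3 j * _ j"] q1 q2 s2
    unfolding c suci3_nodes_table atMost_0 using assms(1)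
    by (simp add: suci3_nodes_table field_simps power2_eq_square)
  also have "\<dots> = 1 / 6" unfolding b by (simp add: field_simps)
  finally show ?thesis
    unfolding third_order_conditions_def using rows s2 s3 c(1) suci3_nodes_table(4) by blast
qed

text \<open>The stability function of the method, as a function of \<open>Z = h l\<close>. The common diagonal coefficient
  \<open>\<gamma>1 / 2\<close> produces the triple pole. The numerator is the cubic Taylor polynomial of
  \<open>(1 - \<gamma>1 Z / 2)\<^sup>3 exp Z\<close>, as order three requires.\<close>

definition suci3_amp :: "real \<Rightarrow> complex \<Rightarrow> complex" where
  "suci3_amp \<gamma>1 Z =
     (1 + of_real (1 - 3 * \<gamma>1 / 2) * Z + of_real (1 / 2 - 3 * \<gamma>1 / 2 + 3 * \<gamma>1\<^sup>2 / 4) * Z\<^sup>2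
        + of_real (1 / 6 - 3 * \<gamma>1 / 4 + 3 * \<gamma>1\<^sup>2 / 4 - \<gamma>1 ^ 3 / 8) * Z ^ 3)
     / (1 - of_real (\<gamma>1 / 2) * Z) ^ 3"

text \<open>Multiplying the last stage by \<open>q\<^sup>3\<close>, where \<open>q = 1 - \<gamma>1 Z / 2\<close>, allows the implicit stages 1 and 2
  to be eliminated without division.\<close>

lemma suci3_amplification:
  assumes "\<gamma>1 > 0" "\<gamma>2 \<noteq> 0" "\<gamma>2 \<noteq> \<gamma>1" and nz: "1 - of_real (\<gamma>1 / 2) * (of_real h * l) \<noteq> 0"
    and z: "\<And>i. i \<le> 3 \<Longrightarrow> z i = z 0 + of_real h * (\<Sum>j\<le>i. of_real (suci3_coeffs \<gamma>1 \<gamma>2 i j) * (l * z j))"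
  shows "z 3 = suci3_amp \<gamma>1 (of_real h * l) * z 0"
proof -
  obtain b where b: "b * (\<gamma>2 * (\<gamma>2 - \<gamma>1)) = (3 * \<gamma>1\<^sup>2 - 6 * \<gamma>1 + 2) / 6"
    and c: "suci3_coeffs \<gamma>1 \<gamma>2 0 0 = 0"
    "suci3_coeffs \<gamma>1 \<gamma>2 1 0 = \<gamma>1 / 2" "suci3_coeffs \<gamma>1 \<gamma>2 1 1 = \<gamma>1 / 2"
    "suci3_coeffs \<gamma>1 \<gamma>2 2 0 = (- \<gamma>1\<^sup>2 + 3 * \<gamma>1 * \<gamma>2 - \<gamma>2\<^sup>2) / (2 * \<gamma>1)"
    "suci3_coeffs \<gamma>1 \<gamma>2 2 1 = \<gamma>2 * (\<gamma>2 - \<gamma>1) / (2 * \<gamma>1)" "suci3_coeffs \<gamma>1 \<gamma>2 2 2 = \<gamma>1 / 2"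
    "suci3_coeffs \<gamma>1 \<gamma>2 3 0 = (- \<gamma>1\<^sup>2 + (3 - 2 * b) * \<gamma>1 + 2 * b * \<gamma>2 - 1) / (2 * \<gamma>1)"
    "suci3_coeffs \<gamma>1 \<gamma>2 3 1 = (- 2 * b * \<gamma>2 - \<gamma>1 + 1) / (2 * \<gamma>1)"
    "suci3_coeffs \<gamma>1 \<gamma>2 3 2 = b" "suci3_coeffs \<gamma>1 \<gamma>2 3 3 = \<gamma>1 / 2"
    by (rule suci3_coeffs_table[OF assms(1-3)])
  define Z where "Z = of_real h * l"
  define g a20 a21 a30 a31 where "g = \<gamma>1 / 2" and "a20 = suci3_coeffs \<gamma>1 \<gamma>2 2 0"
    and "a21 = suci3_coeffs \<gamma>1 \<gamma>2 2 1" and "a30 = suci3_coeffs \<gamma>1 \<gamma>2 3 0" and "a31 = suci3_coeffs \<gamma>1 \<gamma>2 3 1"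
  note defs = g_def a20_def a21_def a30_def a31_def
  define q where "q = 1 - of_real g * Z"
  have q: "q \<noteq> 0" using nz by (simp add: q_def Z_def g_def)
  have z1: "q * z 1 = (1 + of_real g * Z) * z 0"
  proof -
    have "z 1 = z 0 + of_real h * (of_real g * (l * z 0) + of_real g * (l * z 1))"
      using z[of 1] unfolding sum_atMost_1 c g_def by simp
    then have "z 1 - of_real g * Z * z 1 = z 0 + of_real g * Z * z 0"
      unfolding Z_def by (simp only: diff_eq_eq) (simp add: algebra_simps)
    then show ?thesis by (simp add: q_def algebra_simps)
  qed
  have z2: "q * z 2 = (1 + of_real a20 * Z) * z 0 + of_real a21 * Z * z 1"
  proof -
    have "z 2 = z 0 + of_real h * (of_real a20 * (l * z 0) + of_real a21 * (l * z 1) + of_real g * (l * z 2))"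
      using z[of 2] unfolding sum_atMost_2 c(6) g_def a20_def a21_def by simp
    then have "z 2 - of_real g * Z * z 2 = z 0 + of_real a20 * Z * z 0 + of_real a21 * Z * z 1"
      unfolding Z_def by (simp only: diff_eq_eq) (simp add: algebra_simps)
    then show ?thesis by (simp add: q_def algebra_simps)
  qed
  have z3: "q * z 3 = (1 + of_real a30 * Z) * z 0 + of_real a31 * Z * z 1 + of_real b * Z * z 2"
  proof -
    have "z 3 = z 0 + of_real h * (of_real a30 * (l * z 0) + of_real a31 * (l * z 1)
        + of_real b * (l * z 2) + of_real g * (l * z 3))"
      using z[of 3] unfolding sum_atMost_3 c(9,10) g_def a30_def a31_def by simp
    then have "z 3 - of_real g * Z * z 3 =
        z 0 + of_real a30 * Z * z 0 + of_real a31 * Z * z 1 + of_real b * Z * z 2"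
      unfolding Z_def by (simp only: diff_eq_eq) (simp add: algebra_simps)
    then show ?thesis by (simp add: q_def algebra_simps)
  qed
  have "q ^ 3 * z 3 = q * q * ((1 + of_real a30 * Z) * z 0) + of_real a31 * Z * q * (q * z 1)
      + of_real b * Z * (q * (q * z 2))"
    using arg_cong[OF z3, of "\<lambda>x. q * q * x"] by (simp add: algebra_simps power3_eq_cube)
  also have "q * (q * z 2) = q * ((1 + of_real a20 * Z) * z 0) + of_real a21 * Z * (q * z 1)"
    unfolding z2 by (simp add: algebra_simps)
  also have "q * q * ((1 + of_real a30 * Z) * z 0) + of_real a31 * Z * q * (q * z 1)
      + of_real b * Z * (q * ((1 + of_real a20 * Z) * z 0) + of_real a21 * Z * (q * z 1)) =
    (1 + of_real (a30 + a31 + b - 2 * g) * Z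
       + of_real (g\<^sup>2 - 2 * g * a30 + b * (a20 + a21 - g)) * Z\<^sup>2
       + of_real (g\<^sup>2 * (a30 - a31) + g * (b * a21 - b * a20)) * Z ^ 3) * z 0"
    unfolding z1 by (simp add: q_def algebra_simps power2_eq_square power3_eq_cube)
  also have "a30 + a31 + b - 2 * g = 1 - 3 * \<gamma>1 / 2"
    unfolding defs c using assms(1) by (simp add: field_simps power2_eq_square)
  also have "g\<^sup>2 - 2 * g * a30 + b * (a20 + a21 - g) = 1 / 2 - 3 * \<gamma>1 / 2 + 3 * \<gamma>1\<^sup>2 / 4"
    unfolding defs c using assms(1) by (simp add: field_simps power2_eq_square)
  also have "g\<^sup>2 * (a30 - a31) + g * (b * a21 - b * a20) = 1 / 6 - 3 * \<gamma>1 / 4 + 3 * \<gamma>1\<^sup>2 / 4 - \<gamma>1 ^ 3 / 8"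
  proof -
    have "g\<^sup>2 * (a30 - a31) + g * (b * a21 - b * a20) =
        (- (\<gamma>1 ^ 3) + 4 * \<gamma>1\<^sup>2 - 2 * \<gamma>1) / 8 + b * (\<gamma>2 * (\<gamma>2 - \<gamma>1)) / 2"
      unfolding defs c using assms(1) by (simp add: field_simps power2_eq_square power3_eq_cube)
    then show ?thesis unfolding b by (simp add: field_simps)
  qed
  finally show ?thesis
    using q unfolding suci3_amp_def Z_def[symmetric] g_def[symmetric] q_def[symmetric]
    by (simp add: field_simps)
qed

text \<open>Numerator and denominator both have degree three, so the limit is the quotient of the leading
  coefficients; the substitution \<open>w = 1 / Z\<close> turns it into continuity at 0.\<close>

lemma suci3_amp_at_infinity:
  assumes "\<gamma>1 > 0"
  shows "(suci3_amp \<gamma>1 \<longlongrightarrow> of_real (R_inf \<gamma>1)) at_infinity"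
proof -
  define p1 p2 p3 g where "p1 = complex_of_real (1 - 3 * \<gamma>1 / 2)"
    and "p2 = complex_of_real (1 / 2 - 3 * \<gamma>1 / 2 + 3 * \<gamma>1\<^sup>2 / 4)"
    and "p3 = complex_of_real (1 / 6 - 3 * \<gamma>1 / 4 + 3 * \<gamma>1\<^sup>2 / 4 - \<gamma>1 ^ 3 / 8)"
    and "g = complex_of_real (\<gamma>1 / 2)"
  define f where "f w = (w ^ 3 + p1 * w\<^sup>2 + p2 * w + p3) / (w - g) ^ 3" for w
  have g: "g \<noteq> 0" using assms by (simp add: g_def)
  have "isCont f 0"
    unfolding f_def using g by (intro continuous_intros) auto
  then have "((\<lambda>Z. f (inverse Z)) \<longlongrightarrow> f 0) at_infinity"
    by (rule isCont_tendsto_compose[OF _ tendsto_inverse_0])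
  moreover have "f 0 = of_real (R_inf \<gamma>1)"
  proof -
    have "R_inf \<gamma>1 = (1 / 6 - 3 * \<gamma>1 / 4 + 3 * \<gamma>1\<^sup>2 / 4 - \<gamma>1 ^ 3 / 8) / (- (\<gamma>1 / 2)) ^ 3"
      using assms by (simp add: R_inf_def field_simps power3_eq_cube)
    then show ?thesis by (simp add: f_def p3_def g_def)
  qed
  moreover have "eventually (\<lambda>Z. f (inverse Z) = suci3_amp \<gamma>1 Z) at_infinity"
  proof -
    have "eventually (\<lambda>Z::complex. Z \<noteq> 0) at_infinity"
      by (rule eventually_not_equal_at_infinity)
    then show ?thesis
    proof eventually_elim
      case (elim Z)
      have "(inverse Z) ^ 3 + p1 * (inverse Z)\<^sup>2 + p2 * inverse Z + p3 =
          (1 + p1 * Z + p2 * Z\<^sup>2 + p3 * Z ^ 3) / Z ^ 3"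
        using elim by (simp add: field_simps power2_eq_square power3_eq_cube)
      moreover have "(inverse Z - g) ^ 3 = (1 - g * Z) ^ 3 / Z ^ 3"
        unfolding power_divide[symmetric] using elim by (simp add: field_simps)
      ultimately show ?case
        using elim unfolding f_def suci3_amp_def p1_def[symmetric] p2_def[symmetric] p3_def[symmetric] g_def[symmetric]
        by simp
    qed
  qed
  ultimately show ?thesis using tendsto_cong by fastforce
qed

text \<open>The difference of the squared moduli of denominator and numerator on the imaginary axis is an even
  polynomial in \<open>y\<close> of degree six. Its constant term and its coefficient of \<open>y\<^sup>2\<close> vanish by the order conditions; up to
  the common factor \<open>3 / 16\<close>, the other two coefficients are the expressions in the stability
  criterion. The sextic one, \<open>g\<^sup>6 - p3\<^sup>2\<close>, factors as a difference of squares.\<close>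

lemma suci3_amp_imag_le_1_iff:
  shows "norm (suci3_amp \<gamma>1 (\<i> * of_real y)) \<le> 1 \<longleftrightarrow>
    0 \<le> (- (4/3) * \<gamma>1 ^ 3 + 4 * \<gamma>1\<^sup>2 - (8/3) * \<gamma>1 + 4/9) * y ^ 4
      + (\<gamma>1 - 1/3) * (\<gamma>1 - 2/3) * (\<gamma>1 ^ 3 - 3 * \<gamma>1\<^sup>2 + 3 * \<gamma>1 - 2/3) * y ^ 6"
proof -
  define p1 p2 p3 g where "p1 = 1 - 3 * \<gamma>1 / 2"
    and "p2 = 1 / 2 - 3 * \<gamma>1 / 2 + 3 * \<gamma>1\<^sup>2 / 4"
    and "p3 = 1 / 6 - 3 * \<gamma>1 / 4 + 3 * \<gamma>1\<^sup>2 / 4 - \<gamma>1 ^ 3 / 8"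
    and "g = \<gamma>1 / 2"
  define P where "P = 1 + of_real p1 * (\<i> * of_real y) + of_real p2 * (\<i> * of_real y)\<^sup>2 + of_real p3 * (\<i> * of_real y) ^ 3"
  define q where "q = 1 - of_real g * (\<i> * of_real y)"
  have amp: "suci3_amp \<gamma>1 (\<i> * of_real y) = P / q ^ 3"
    by (simp add: suci3_amp_def P_def q_def p1_def p2_def p3_def g_def)
  have P: "P = Complex (1 - p2 * y\<^sup>2) (p1 * y - p3 * y ^ 3)"
    by (simp add: P_def complex_eq_iff power2_eq_square power3_eq_cube)
  have q2: "(norm q)\<^sup>2 = 1 + g\<^sup>2 * y\<^sup>2"
    by (simp add: q_def cmod_power2 power_mult_distrib)
  have q: "norm q > 0"
  proof -
    have "(norm q)\<^sup>2 > 0" unfolding q2 by (intro add_pos_nonneg) auto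
    then show ?thesis by simp
  qed
  have "norm (P / q ^ 3) \<le> 1 \<longleftrightarrow> norm P \<le> norm q ^ 3"
    using q by (simp add: norm_divide norm_power)
  also have "\<dots> \<longleftrightarrow> (norm P)\<^sup>2 \<le> (norm q ^ 3)\<^sup>2"
    by (rule power_mono_iff[symmetric]) auto
  also have "(norm q ^ 3)\<^sup>2 = (1 + g\<^sup>2 * y\<^sup>2) ^ 3"
    unfolding q2[symmetric] by (simp add: power_mult[symmetric])
  also have "(norm P)\<^sup>2 = (1 - p2 * y\<^sup>2)\<^sup>2 + (p1 * y - p3 * y ^ 3)\<^sup>2"
    unfolding P by (simp add: cmod_power2)
  also have "\<dots> \<le> (1 + g\<^sup>2 * y\<^sup>2) ^ 3 \<longleftrightarrow> 0 \<le> (1 + g\<^sup>2 * y\<^sup>2) ^ 3 - ((1 - p2 * y\<^sup>2)\<^sup>2 + (p1 * y - p3 * y ^ 3)\<^sup>2)"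
    by simp
  also have "(1 + g\<^sup>2 * y\<^sup>2) ^ 3 - ((1 - p2 * y\<^sup>2)\<^sup>2 + (p1 * y - p3 * y ^ 3)\<^sup>2) =
      (3 * g\<^sup>2 + 2 * p2 - p1\<^sup>2) * y\<^sup>2 + (3 * g ^ 4 - p2\<^sup>2 + 2 * p1 * p3) * y ^ 4 + ((g ^ 3 + p3) * (g ^ 3 - p3)) * y ^ 6"
    by (simp add: algebra_simps eval_nat_numeral)
  also have "3 * g\<^sup>2 + 2 * p2 - p1\<^sup>2 = 0"
    by (simp add: g_def p1_def p2_def field_simps power2_eq_square)
  also have "3 * g ^ 4 - p2\<^sup>2 + 2 * p1 * p3 = 3 / 16 * (- (4/3) * \<gamma>1 ^ 3 + 4 * \<gamma>1\<^sup>2 - (8/3) * \<gamma>1 + 4/9)"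
    by (simp add: g_def p1_def p2_def p3_def field_simps eval_nat_numeral)
  also have "g ^ 3 + p3 = 3 / 4 * ((\<gamma>1 - 1/3) * (\<gamma>1 - 2/3))"
    by (simp add: g_def p3_def field_simps eval_nat_numeral)
  also have "g ^ 3 - p3 = 1 / 4 * (\<gamma>1 ^ 3 - 3 * \<gamma>1\<^sup>2 + 3 * \<gamma>1 - 2/3)"
    by (simp add: g_def p3_def field_simps eval_nat_numeral)
  also have "0 * y\<^sup>2 + 3 / 16 * A * y ^ 4 + 3 / 4 * B * (1 / 4 * C) * y ^ 6 = 3 / 16 * (A * y ^ 4 + B * C * y ^ 6)" for A B C
    by (simp add: algebra_simps)
  also have "0 \<le> 3 / 16 * x \<longleftrightarrow> 0 \<le> x" for x :: real
    by (simp add: zero_le_mult_iff)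
  finally show ?thesis unfolding amp .
qed

text \<open>Necessity: after division by \<open>y\<^sup>4\<close>, let \<open>y\<close> tend to 0 for the quartic coefficient and take
  \<open>y\<close> large for the sextic one.\<close>

lemma quartic_sextic_nonneg_iff:
  fixes A B :: real
  shows "(\<forall>y\<ge>0. 0 \<le> A * y ^ 4 + B * y ^ 6) \<longleftrightarrow> 0 \<le> B \<and> 0 \<le> A"
proof
  assume R: "\<forall>y\<ge>0. 0 \<le> A * y ^ 4 + B * y ^ 6"
  have lin: "0 \<le> A + B * t" if "t > 0" for t
  proof -
    have "0 \<le> A * sqrt t ^ 4 + B * sqrt t ^ 6" using R that by simp
    also have "\<dots> = t\<^sup>2 * (A + B * t)"
    proof -
      have "sqrt t ^ 4 = (sqrt t ^ 2) ^ 2" "sqrt t ^ 6 = (sqrt t ^ 2) ^ 3"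
        by (simp_all only: power_mult[symmetric]) simp_all
      then show ?thesis using that by (simp add: algebra_simps eval_nat_numeral)
    qed
    finally show ?thesis using that by (simp add: zero_le_mult_iff)
  qed
  have "0 \<le> A"
  proof (rule tendsto_lowerbound)
    show "((\<lambda>t. A + B * t) \<longlongrightarrow> A) (at_right 0)" by (auto intro!: tendsto_eq_intros)
    show "eventually (\<lambda>t. 0 \<le> A + B * t) (at_right 0)"
      using eventually_at_right_less by eventually_elim (rule lin)
  qed simp
  moreover have "0 \<le> B"
  proof (rule ccontr)
    assume "\<not> 0 \<le> B"
    then have "A + B * ((A + 1) / (- B)) = - 1" "(A + 1) / (- B) > 0"
      using \<open>0 \<le> A\<close> by (auto simp: field_simps)
    then show False using lin by fastforce
  qed
  ultimately show "0 \<le> B \<and> 0 \<le> A" by blast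
qed auto

lemma D_num_suci3:
  assumes "\<gamma>1 > 0" "\<gamma>2 \<noteq> 0" "\<gamma>2 \<noteq> \<gamma>1" and \<xi>: "\<xi> \<in> {0..<1}" and \<omega>: "\<omega> > 0"
  shows "D_num 3 (suci3_nodes \<gamma>1 \<gamma>2) (suci3_coeffs \<gamma>1 \<gamma>2) \<xi> \<omega> h =
    modal_mat (modal_rate \<xi> \<omega>) (suci3_amp \<gamma>1 (of_real h * modal_rate \<xi> \<omega>))"
proof (rule D_num_eq_modal_mat[OF \<xi> \<omega>])
  show "suci3_coeffs \<gamma>1 \<gamma>2 0 0 = 0" by (simp add: suci3_coeffs_def Let_def)
  show "suci3_nodes \<gamma>1 \<gamma>2 0 = 0" by (rule suci3_nodes_table)
  have "1 - of_real (\<gamma>1 / 2) * (of_real h * modal_rate \<xi> \<omega>) \<noteq> 0"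
  proof
    assume *: "1 - of_real (\<gamma>1 / 2) * (of_real h * modal_rate \<xi> \<omega>) = 0"
    from arg_cong[OF *, of Im] have "h = 0"
      using modal_rate(1)[OF \<xi> \<omega>] \<open>\<gamma>1 > 0\<close> by simp
    with * show False by simp
  qed
  then show "z 3 = suci3_amp \<gamma>1 (of_real h * modal_rate \<xi> \<omega>) * z 0"
    if "\<And>i. i \<le> 3 \<Longrightarrow> z i = z 0 + of_real h *
      (\<Sum>j\<le>i. of_real (suci3_coeffs \<gamma>1 \<gamma>2 i j) * (modal_rate \<xi> \<omega> * z j))" for z
    using that by (rule suci3_amplification[OF assms(1-3)])
qed

section \<open>Stability\<close>

text \<open>Without damping the modal rate is \<open>\<i> \<omega>\<close>, so the spectral radius is the modulus of the stability
  function on the imaginary axis.\<close>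

lemma suci3_stable_iff:
  assumes "\<gamma>1 > 0" "\<gamma>2 \<noteq> 0" "\<gamma>2 \<noteq> \<gamma>1"
  shows "unconditionally_stable 3 (suci3_nodes \<gamma>1 \<gamma>2) (suci3_coeffs \<gamma>1 \<gamma>2) \<longleftrightarrow>
    (\<gamma>1 - 1/3) * (\<gamma>1 - 2/3) * (\<gamma>1 ^ 3 - 3 * \<gamma>1\<^sup>2 + 3 * \<gamma>1 - 2/3) \<ge> 0 \<and>
    - (4/3) * \<gamma>1 ^ 3 + 4 * \<gamma>1\<^sup>2 - (8/3) * \<gamma>1 + 4/9 \<ge> 0"
proof -
  have "spectral_radius (map_mat complex_of_real
      (D_num 3 (suci3_nodes \<gamma>1 \<gamma>2) (suci3_coeffs \<gamma>1 \<gamma>2) 0 \<omega> h)) =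
    norm (suci3_amp \<gamma>1 (\<i> * of_real (\<omega> * h)))" if \<omega>: "\<omega> > 0" for \<omega> h
  proof -
    have z: "0 \<in> {0..<1::real}" by simp
    have "modal_rate 0 \<omega> = \<i> * of_real \<omega>" by (simp add: modal_rate_def complex_eq_iff)
    then have e: "of_real h * modal_rate 0 \<omega> = \<i> * of_real (\<omega> * h)" by simp
    show ?thesis
      unfolding D_num_suci3[OF assms z \<omega>] e
      by (rule spectral_radius_modal_mat) (use modal_rate(1)[OF z \<omega>] in simp)
  qed
  then have "unconditionally_stable 3 (suci3_nodes \<gamma>1 \<gamma>2) (suci3_coeffs \<gamma>1 \<gamma>2) \<longleftrightarrow>
      (\<forall>\<omega>>0. \<forall>h\<ge>0. norm (suci3_amp \<gamma>1 (\<i> * of_real (\<omega> * h))) \<le> 1)"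
    unfolding unconditionally_stable_def by simp
  also have "\<dots> \<longleftrightarrow> (\<forall>y\<ge>0. norm (suci3_amp \<gamma>1 (\<i> * of_real y)) \<le> 1)"
  proof safe
    fix y :: real
    assume "\<forall>\<omega>>0. \<forall>h\<ge>0. norm (suci3_amp \<gamma>1 (\<i> * of_real (\<omega> * h))) \<le> 1" "y \<ge> 0"
    from this(1)[rule_format, of 1 y] this(2)
    show "norm (suci3_amp \<gamma>1 (\<i> * of_real y)) \<le> 1" by simp
  next
    fix \<omega> h :: real
    assume *: "\<forall>y\<ge>0. norm (suci3_amp \<gamma>1 (\<i> * of_real y)) \<le> 1" and "\<omega> > 0" "h \<ge> 0"
    have "\<omega> * h \<ge> 0" using \<open>\<omega> > 0\<close> \<open>h \<ge> 0\<close> by simp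
    with * show "norm (suci3_amp \<gamma>1 (\<i> * of_real (\<omega> * h))) \<le> 1" by blast
  qed
  finally show ?thesis
    unfolding suci3_amp_imag_le_1_iff quartic_sextic_nonneg_iff .
qed

text \<open>The quartic condition is \<open>q x \<le> 0\<close> for the cubic \<open>q\<close> below, whose roots are about 0.258, 0.605 and
  2.137; \<open>s\<close> is the largest. The sextic condition has the sign of
  \<open>(x - 1/3) (x - 2/3) c x\<close>, where \<open>c\<close> is increasing with its only zero near 0.307. For
  \<open>x \<ge> 2/3\<close> the sextic condition holds, and \<open>q x \<le> 0\<close> means \<open>x \<le> s\<close>. For smaller \<open>x\<close> one of the two
  fails: between \<open>1/3\<close> and \<open>2/3\<close> the sextic one, below \<open>3/10\<close> the sextic one as \<open>c\<close> is negative
  there, and on the remaining interval the quartic one.\<close>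

lemma suci3_stability_limit:
  obtains s :: real where "\<bar>s - 2.137158043\<bar> \<le> 1 / 10 ^ 8"
    and "\<And>x. x > 0 \<Longrightarrow>
      ((x - 1/3) * (x - 2/3) * (x ^ 3 - 3 * x\<^sup>2 + 3 * x - 2/3) \<ge> 0 \<and>
        - (4/3) * x ^ 3 + 4 * x\<^sup>2 - (8/3) * x + 4/9 \<ge> 0) \<longleftrightarrow> x \<in> {2/3..s}"
proof -
  define q where "q x = 3 * x ^ 3 - 9 * x\<^sup>2 + 6 * x - 1" for x :: real
  define c where "c x = (x - 1) ^ 3 + 1 / 3" for x :: real
  have Q: "- (4/3) * x ^ 3 + 4 * x\<^sup>2 - (8/3) * x + 4/9 \<ge> 0 \<longleftrightarrow> q x \<le> 0" for x
    unfolding q_def by linarith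
  have C: "x ^ 3 - 3 * x\<^sup>2 + 3 * x - 2/3 = c x" for x
    by (simp add: c_def power2_eq_square power3_eq_cube algebra_simps)
  have c_mono: "c x < c y" if "x < y" for x y
  proof -
    have "c y - c x = (y - x) * (((x - 1) + (y - 1))\<^sup>2 + ((x - 1)\<^sup>2 + (y - 1)\<^sup>2)) / 2"
      by (simp add: c_def power2_eq_square power3_eq_cube field_simps)
    moreover have "(x - 1)\<^sup>2 + (y - 1)\<^sup>2 > 0" using that by (auto simp: sum_power2_gt_zero_iff)
    then have "((x - 1) + (y - 1))\<^sup>2 + ((x - 1)\<^sup>2 + (y - 1)\<^sup>2) > 0"
      by (rule add_nonneg_pos[OF zero_le_power2])
    then have "(y - x) * (((x - 1) + (y - 1))\<^sup>2 + ((x - 1)\<^sup>2 + (y - 1)\<^sup>2)) > 0"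
      using that by (intro mult_pos_pos) simp_all
    ultimately show ?thesis by linarith
  qed
  \<comment> \<open>The endpoints are the centre of the claimed interval minus and plus its radius.\<close>
  have "\<exists>s\<ge>2.137158033. s \<le> 2.137158053 \<and> q s = 0"
    by (rule IVT') (auto simp: q_def power2_eq_square power3_eq_cube intro!: continuous_intros)
  then obtain s where s: "2.137158033 \<le> s" "s \<le> 2.137158053" "q s = 0" by blast
  show thesis
  proof (rule that[of s])
    show "\<bar>s - 2.137158043\<bar> \<le> 1 / 10 ^ 8" using s(1,2) unfolding abs_le_iff by simp
    fix x :: real assume "x > 0"
    show "((x - 1/3) * (x - 2/3) * (x ^ 3 - 3 * x\<^sup>2 + 3 * x - 2/3) \<ge> 0 \<and>
        - (4/3) * x ^ 3 + 4 * x\<^sup>2 - (8/3) * x + 4/9 \<ge> 0) \<longleftrightarrow> x \<in> {2/3..s}"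
      unfolding Q C
    proof (cases "x \<ge> 2 / 3")
      case True
      have "c x > 0" using c_mono[of "1/3" x] True by (simp add: c_def power3_eq_cube)
      then have "(x - 1/3) * (x - 2/3) * c x \<ge> 0" using True by simp
      moreover have "q x \<le> 0 \<longleftrightarrow> x \<le> s"
      proof -
        \<comment> \<open>The cofactor of the root \<open>s\<close> in \<open>q\<close>; its own roots lie below \<open>2/3\<close>.\<close>
        define k where "k = 3 * x\<^sup>2 + (3 * s - 9) * x + (3 * s\<^sup>2 - 9 * s + 6)"
        have "q x = q x - q s" using s(3) by simp
        also have "\<dots> = (x - s) * k"
          by (simp add: q_def k_def power2_eq_square power3_eq_cube algebra_simps)
        finally have "q x = (x - s) * k" .
        moreover have "k > 0"
        proof -
          have "k = (3 * (x + 2/3) + (3 * s - 9)) * (x - 2/3) + (s * (3 * s - 7) + 4/3)"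
            by (simp add: k_def power2_eq_square algebra_simps)
          moreover have "(3 * (x + 2/3) + (3 * s - 9)) * (x - 2/3) \<ge> 0"
            using True s(1) by (intro mult_nonneg_nonneg) auto
          moreover have "s * (7 - 3 * s) \<le> 2.137158053 * (7 - 3 * 2.137158033)"
            using s(1,2) by (intro mult_mono) auto
          then have "s * (3 * s - 7) + 4/3 > 0" by (simp add: algebra_simps)
          ultimately show ?thesis by linarith
        qed
        ultimately show ?thesis by (simp add: mult_le_0_iff)
      qed
      ultimately show "((x - 1/3) * (x - 2/3) * c x \<ge> 0 \<and> q x \<le> 0) \<longleftrightarrow> x \<in> {2/3..s}"
        using True by simp
    next
      case False
      have "\<not> ((x - 1/3) * (x - 2/3) * c x \<ge> 0 \<and> q x \<le> 0)"
      proof (cases "x > 1 / 3")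
        case True
        have "c x > 0" using c_mono[of "1/3" x] True by (simp add: c_def power3_eq_cube)
        then show ?thesis using True False by (simp add: zero_le_mult_iff not_le)
      next
        case x: False
        show ?thesis
        proof (cases "x \<ge> 3 / 10")
          case True
          have "x ^ 3 \<ge> (3/10) ^ 3" using True by (intro power_mono) auto
          then have pos1: "3 * (x ^ 3 - (3/10) ^ 3) \<ge> 0" by simp
          have pos2: "(x - 3/10) * (6 - 9 * (x + 3/10)) \<ge> 0"
            using True x by (intro mult_nonneg_nonneg) auto
          have "q x = 3 * (x ^ 3 - (3/10) ^ 3) + (x - 3/10) * (6 - 9 * (x + 3/10)) + 71/1000"
            by (simp add: q_def power2_eq_square power3_eq_cube field_simps)
          also have "\<dots> > 0"
            by (intro add_nonneg_pos add_nonneg_nonneg pos1 pos2) simp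
          finally have "q x > 0" .
          then show ?thesis by simp
        next
          case 3: False
          have "c x < 0" using c_mono[of x "3/10"] 3 by (simp add: c_def power3_eq_cube)
          moreover have "(x - 1/3) * (x - 2/3) > 0" using 3 by (intro mult_neg_neg) auto
          ultimately have "(x - 1/3) * (x - 2/3) * c x < 0" by (intro mult_pos_neg)
          then show ?thesis by linarith
        qed
      qed
      then show "((x - 1/3) * (x - 2/3) * c x \<ge> 0 \<and> q x \<le> 0) \<longleftrightarrow> x \<in> {2/3..s}"
        using False by simp
    qed
  qed
qed

section \<open>The limit of large frequency or step size\<close>

text \<open>Already the interval from \<open>2/3\<close>, where the value is 1, to 1, where it is \<open>-1/3\<close>, suffices for the
  intermediate value theorem.\<close>

lemma R_inf_surj:
  assumes "\<rho> \<in> {0..1}"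
  shows "\<exists>x\<in>{2/3..1}. R_inf x = \<rho>"
proof -
  have "\<exists>x\<ge>2/3. x \<le> 1 \<and> R_inf x = \<rho>"
  proof (rule IVT2')
    show "R_inf 1 \<le> \<rho>" "\<rho> \<le> R_inf (2/3)"
      using assms by (simp_all add: R_inf_def power2_eq_square power3_eq_cube)
    show "continuous_on {2/3..1} R_inf"
      unfolding R_inf_def by (auto intro!: continuous_intros)
  qed simp
  then show ?thesis by auto
qed

text \<open>The modal rate has modulus \<open>\<omega>\<close>, so both limits lead to the point at infinity of
  the stability function.\<close>

lemma scaled_modal_rate_at_infinity:
  assumes "\<xi> \<in> {0..<1}"
  shows "h > 0 \<Longrightarrow> filterlim (\<lambda>\<omega>. of_real h * modal_rate \<xi> \<omega>) at_infinity at_top"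
    and "\<omega> > 0 \<Longrightarrow> filterlim (\<lambda>h. of_real h * modal_rate \<xi> \<omega>) at_infinity at_top"
proof -
  assume h: "h > 0"
  have "eventually (\<lambda>\<omega>. h * \<omega> = norm (of_real h * modal_rate \<xi> \<omega>)) at_top"
    using eventually_gt_at_top[of 0]
    by eventually_elim (use h in \<open>simp add: norm_mult modal_rate(2)[OF assms]\<close>)
  moreover have "filterlim (\<lambda>\<omega>. h * \<omega>) at_top at_top"
    by (rule filterlim_tendsto_pos_mult_at_top[OF tendsto_const h filterlim_ident])
  ultimately show "filterlim (\<lambda>\<omega>. of_real h * modal_rate \<xi> \<omega>) at_infinity at_top"
    unfolding filterlim_at_infinity_conv_norm_at_top by (simp add: filterlim_cong)
next
  assume \<omega>: "\<omega> > 0"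
  have "eventually (\<lambda>h. h * \<omega> = norm (of_real h * modal_rate \<xi> \<omega>)) at_top"
    using eventually_gt_at_top[of 0]
    by eventually_elim (use \<omega> in \<open>simp add: norm_mult modal_rate(2)[OF assms]\<close>)
  moreover have "filterlim (\<lambda>h. h * \<omega>) at_top at_top"
    by (rule filterlim_at_top_mult_tendsto_pos[OF tendsto_const \<omega> filterlim_ident])
  ultimately show "filterlim (\<lambda>h. of_real h * modal_rate \<xi> \<omega>) at_infinity at_top"
    unfolding filterlim_at_infinity_conv_norm_at_top by (simp add: filterlim_cong)
qed

lemma suci3_char_poly_limit:
  assumes \<gamma>: "\<gamma>1 > 0" "\<gamma>2 \<noteq> 0" "\<gamma>2 \<noteq> \<gamma>1" and \<xi>: "\<xi> \<in> {0..<1}" and h: "h > 0"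
  shows "((\<lambda>\<omega>. coeff (char_poly (D_num 3 (suci3_nodes \<gamma>1 \<gamma>2) (suci3_coeffs \<gamma>1 \<gamma>2) \<xi> \<omega> h)) k)
    \<longlongrightarrow> coeff ([:- R_inf \<gamma>1, 1:] ^ 2) k) at_top"
proof -
  define w where "w \<omega> = suci3_amp \<gamma>1 (of_real h * modal_rate \<xi> \<omega>)" for \<omega>
  have w: "(w \<longlongrightarrow> of_real (R_inf \<gamma>1)) at_top"
    unfolding w_def
    by (rule filterlim_compose[OF suci3_amp_at_infinity[OF \<gamma>(1)] scaled_modal_rate_at_infinity(1)[OF \<xi> h]])
  have "eventually (\<lambda>\<omega>. coeff [:(norm (w \<omega>))\<^sup>2, - 2 * Re (w \<omega>), 1:] k =
      coeff (char_poly (D_num 3 (suci3_nodes \<gamma>1 \<gamma>2) (suci3_coeffs \<gamma>1 \<gamma>2) \<xi> \<omega> h)) k) at_top"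
    using eventually_gt_at_top[of 0]
  proof eventually_elim
    case (elim \<omega>)
    then have "Im (modal_rate \<xi> \<omega>) \<noteq> 0" using modal_rate(1)[OF \<xi>] by force
    then show ?case by (simp add: D_num_suci3[OF \<gamma> \<xi> elim] char_poly_modal_mat w_def)
  qed
  moreover have "((\<lambda>\<omega>. coeff [:(norm (w \<omega>))\<^sup>2, - 2 * Re (w \<omega>), 1:] k) \<longlongrightarrow>
      coeff [:(R_inf \<gamma>1)\<^sup>2, - 2 * R_inf \<gamma>1, 1:] k) at_top"
  proof -
    have "((\<lambda>\<omega>. (norm (w \<omega>))\<^sup>2) \<longlongrightarrow> (R_inf \<gamma>1)\<^sup>2) at_top"
      using tendsto_power[OF tendsto_norm[OF w], of 2] by simp
    moreover have "((\<lambda>\<omega>. - 2 * Re (w \<omega>)) \<longlongrightarrow> - 2 * R_inf \<gamma>1) at_top"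
      using tendsto_mult[OF tendsto_const[of "-2"] tendsto_Re[OF w]] by simp
    ultimately show ?thesis
      by (cases k rule: nat.exhaust[case_names 0 Suc]; simp add: coeff_pCons split: nat.split)
  qed
  moreover have "[:- R_inf \<gamma>1, 1:] ^ 2 = [:(R_inf \<gamma>1)\<^sup>2, - 2 * R_inf \<gamma>1, 1:]"
    by (simp add: power2_eq_square)
  ultimately show ?thesis by (simp only: tendsto_cong)
qed

lemma suci3_overshoot_limit:
  fixes \<gamma>1 \<gamma>2 \<xi> \<omega> t p q :: real
  assumes \<gamma>: "\<gamma>1 > 0" "\<gamma>2 \<noteq> 0" "\<gamma>2 \<noteq> \<gamma>1" and \<xi>: "\<xi> \<in> {0..<1}" and \<omega>: "\<omega> > 0"
  defines "y \<equiv> \<lambda>h. num_step 3 (suci3_nodes \<gamma>1 \<gamma>2) (suci3_coeffs \<gamma>1 \<gamma>2) \<xi> \<omega> (\<lambda>_. 0) t h (vec_of_list [p, q])"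
  shows "((\<lambda>h. y h $ 0) \<longlongrightarrow> R_inf \<gamma>1 * p) at_top" "((\<lambda>h. y h $ 1) \<longlongrightarrow> R_inf \<gamma>1 * q) at_top"
proof -
  have \<xi>': "\<bar>\<xi>\<bar> < 1" using \<xi> by simp
  define l where "l = modal_rate \<xi> \<omega>"
  have l: "Im l \<noteq> 0" using modal_rate(1)[OF \<xi> \<omega>] by (simp add: l_def)
  define m where "m = to_modal l (vec_of_list [p, q])"
  define w where "w h = suci3_amp \<gamma>1 (of_real h * l)" for h
  have w: "(w \<longlongrightarrow> of_real (R_inf \<gamma>1)) at_top"
    unfolding w_def l_def
    by (rule filterlim_compose[OF suci3_amp_at_infinity[OF \<gamma>(1)] scaled_modal_rate_at_infinity(2)[OF \<xi> \<omega>]])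
  have y: "y h = from_modal l (w h * m)" for h
    unfolding y_def m_def w_def D_num_mult_vec[OF \<xi>' vec_of_list_2_carrier, symmetric]
      D_num_suci3[OF \<gamma> \<xi> \<omega>] l_def[symmetric]
    by (rule modal_mat_mult[OF l vec_of_list_2_carrier])
  have wm: "((\<lambda>h. w h * m) \<longlongrightarrow> of_real (R_inf \<gamma>1) * m) at_top"
    by (intro tendsto_intros w)
  have m: "Im m / Im l = p" "Re m + Re l * p = q" using l by (simp_all add: m_def to_modal_def)
  have "((\<lambda>h. Im (w h * m) / Im l) \<longlongrightarrow> Im (of_real (R_inf \<gamma>1) * m) / Im l) at_top"
    by (intro tendsto_intros wm l)
  moreover have "Im (of_real (R_inf \<gamma>1) * m) / Im l = R_inf \<gamma>1 * p" using m by (simp flip: m(1))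
  ultimately show 0: "((\<lambda>h. y h $ 0) \<longlongrightarrow> R_inf \<gamma>1 * p) at_top"
    unfolding y from_modal_def vec_of_list_2_index by (simp only:)
  have "((\<lambda>h. Re (w h * m) + Re l * (y h $ 0)) \<longlongrightarrow> Re (of_real (R_inf \<gamma>1) * m) + Re l * (R_inf \<gamma>1 * p)) at_top"
    by (intro tendsto_intros wm 0)
  moreover have "Re (of_real (R_inf \<gamma>1) * m) + Re l * (R_inf \<gamma>1 * p) = R_inf \<gamma>1 * q"
    by (simp add: algebra_simps flip: m(2))
  ultimately show "((\<lambda>h. y h $ 1) \<longlongrightarrow> R_inf \<gamma>1 * q) at_top"
    unfolding y from_modal_def vec_of_list_2_index by (simp only:)
qed

section \<open>Properties of SUCI3\<close>

theorem mainTheorem2: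
  shows "\<exists>\<gamma>star::real. \<bar>\<gamma>star - 2.137158043\<bar> \<le> 1 / 10 ^ 8 \<and>
    (\<forall>\<gamma>1 \<gamma>2 :: real. \<gamma>1 > 0 \<and> \<gamma>2 \<noteq> 0 \<and> \<gamma>2 \<noteq> \<gamma>1 \<longrightarrow>
      (let \<gamma> = suci3_nodes \<gamma>1 \<gamma>2; \<alpha> = suci3_coeffs \<gamma>1 \<gamma>2 in
        accurate_of_order 3 3 \<gamma> \<alpha> \<and>
        (unconditionally_stable 3 \<gamma> \<alpha> \<longleftrightarrow>
           (\<gamma>1 - 1/3) * (\<gamma>1 - 2/3) * (\<gamma>1 ^ 3 - 3 * \<gamma>1\<^sup>2 + 3 * \<gamma>1 - 2/3) \<ge> 0 \<and>
           - (4/3) * \<gamma>1 ^ 3 + 4 * \<gamma>1\<^sup>2 - (8/3) * \<gamma>1 + 4/9 \<ge> 0) \<and>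
        (unconditionally_stable 3 \<gamma> \<alpha> \<longleftrightarrow> \<gamma>1 \<in> {2/3..\<gamma>star}) \<and>
        (\<forall>h>0. \<forall>\<xi>\<in>{0..<1}. \<forall>k.
           ((\<lambda>\<omega>. coeff (char_poly (D_num 3 \<gamma> \<alpha> \<xi> \<omega> h)) k)
              \<longlongrightarrow> coeff ([:- R_inf \<gamma>1, 1:] ^ 2) k) at_top) \<and>
        (\<forall>\<omega>>0. \<forall>\<xi>\<in>{0..<1}. \<forall>t0 u0 v0.
           ((\<lambda>h. num_step 3 \<gamma> \<alpha> \<xi> \<omega> (\<lambda>_. 0) t0 h (vec_of_list [u0, v0]) $ 0)
              \<longlongrightarrow> R_inf \<gamma>1 * u0) at_top \<and>
           ((\<lambda>h. num_step 3 \<gamma> \<alpha> \<xi> \<omega> (\<lambda>_. 0) t0 h (vec_of_list [u0, v0]) $ 1)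
              \<longlongrightarrow> R_inf \<gamma>1 * v0) at_top))) \<and>
    (\<forall>\<rho>\<in>{0..1}. \<exists>\<gamma>1\<in>{2/3..\<gamma>star}. R_inf \<gamma>1 = \<rho>)"
proof -
  obtain s :: real where s: "\<bar>s - 2.137158043\<bar> \<le> 1 / 10 ^ 8"
    and iff: "\<And>x. x > 0 \<Longrightarrow>
      ((x - 1/3) * (x - 2/3) * (x ^ 3 - 3 * x\<^sup>2 + 3 * x - 2/3) \<ge> 0 \<and>
        - (4/3) * x ^ 3 + 4 * x\<^sup>2 - (8/3) * x + 4/9 \<ge> 0) \<longleftrightarrow> x \<in> {2/3..s}"
    by (rule suci3_stability_limit) blast
  have "1 \<le> s" using s unfolding abs_le_iff by simp
  then have "{2/3..1} \<subseteq> {2/3..s}" by auto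
  then have surj: "\<forall>\<rho>\<in>{0..1}. \<exists>\<gamma>1\<in>{2/3..s}. R_inf \<gamma>1 = \<rho>"
    using R_inf_surj by blast
  show ?thesis
  proof (rule exI[of _ s], intro conjI s surj allI impI)
    fix \<gamma>1 \<gamma>2 :: real
    assume "\<gamma>1 > 0 \<and> \<gamma>2 \<noteq> 0 \<and> \<gamma>2 \<noteq> \<gamma>1"
    then have \<gamma>: "\<gamma>1 > 0" "\<gamma>2 \<noteq> 0" "\<gamma>2 \<noteq> \<gamma>1" by blast+
    note stable = suci3_stable_iff[OF \<gamma>]
    note order = third_order_accurate[OF suci3_third_order_conditions[OF \<gamma>]]
    show "(let \<gamma> = suci3_nodes \<gamma>1 \<gamma>2; \<alpha> = suci3_coeffs \<gamma>1 \<gamma>2 in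
      accurate_of_order 3 3 \<gamma> \<alpha> \<and>
      (unconditionally_stable 3 \<gamma> \<alpha> \<longleftrightarrow>
         (\<gamma>1 - 1/3) * (\<gamma>1 - 2/3) * (\<gamma>1 ^ 3 - 3 * \<gamma>1\<^sup>2 + 3 * \<gamma>1 - 2/3) \<ge> 0 \<and>
         - (4/3) * \<gamma>1 ^ 3 + 4 * \<gamma>1\<^sup>2 - (8/3) * \<gamma>1 + 4/9 \<ge> 0) \<and>
      (unconditionally_stable 3 \<gamma> \<alpha> \<longleftrightarrow> \<gamma>1 \<in> {2/3..s}) \<and>
      (\<forall>h>0. \<forall>\<xi>\<in>{0..<1}. \<forall>k.
         ((\<lambda>\<omega>. coeff (char_poly (D_num 3 \<gamma> \<alpha> \<xi> \<omega> h)) k)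
            \<longlongrightarrow> coeff ([:- R_inf \<gamma>1, 1:] ^ 2) k) at_top) \<and>
      (\<forall>\<omega>>0. \<forall>\<xi>\<in>{0..<1}. \<forall>t0 u0 v0.
         ((\<lambda>h. num_step 3 \<gamma> \<alpha> \<xi> \<omega> (\<lambda>_. 0) t0 h (vec_of_list [u0, v0]) $ 0)
            \<longlongrightarrow> R_inf \<gamma>1 * u0) at_top \<and>
         ((\<lambda>h. num_step 3 \<gamma> \<alpha> \<xi> \<omega> (\<lambda>_. 0) t0 h (vec_of_list [u0, v0]) $ 1)
            \<longlongrightarrow> R_inf \<gamma>1 * v0) at_top))"
      unfolding Let_def
    proof (intro conjI)
      show "unconditionally_stable 3 (suci3_nodes \<gamma>1 \<gamma>2) (suci3_coeffs \<gamma>1 \<gamma>2) \<longleftrightarrow> \<gamma>1 \<in> {2/3..s}"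
        using stable iff[OF \<gamma>(1)] by (rule trans)
    qed (rule order, rule stable, intro allI impI ballI, rule suci3_char_poly_limit[OF \<gamma>], assumption+,
        intro allI impI ballI conjI, rule suci3_overshoot_limit(1)[OF \<gamma>], assumption+,
        rule suci3_overshoot_limit(2)[OF \<gamma>], assumption+)
  qed
qed

end
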